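(* Let $\mathbf{A}$ be a strongly Fregean algebra. Then: (1) $M(\mathsf{Con}(\mathbf{A}))\subset\mathcal{S}(\mathbf{A})$; (2) if $\mathbf{A}$ is finite, then $M$ establishes a one-to-one correspondence (a bijection) between $\mathsf{Con}(\mathbf{A})$ and $\mathcal{S}(\mathbf{A})$.
   Context: Conventions. $\mathsf{Con}(\mathbf{A})$ is the congruence lattice of an algebra $\mathbf{A}$ (congruences are subsets of $A^2$). $\mathsf{Cm}(\mathbf{A})$ is the set of completely meet irreducible congruences; for $\eta\in\mathsf{Cm}(\mathbf{A})$, $\eta^{+}$ denotes the least congruence strictly greater than $\eta$. For $\alpha\le\beta$ in $\mathsf{Con}(\mathbf{A})$ let $I[\alpha,\beta]=\{\gamma:\alpha\le\gamma\le\beta\}$. Write $I[\alpha,\beta]\nearrow I[\gamma,\delta]$ (equivalently $I[\gamma,\delta]\searrow I[\alpha,\beta]$) if $\beta\wedge\gamma=\alpha$ and $\beta\vee\gamma=\delta$. Two intervals are projective if they are connected by a finite sequence of steps $\nearrow,\searrow$. When $\mathsf{Con}(\mathbf{A})$ is modular, for $\varphi,\psi\in\mathsf{Cm}(\mathbf{A})$ put $\varphi\sim\psi$ iff $I[\varphi,\varphi^{+}]$ and $I[\psi,\psi^{+}]$ are projective; this is an equivalence relation. The language contains a distinguished constant term $1$. $\Theta_{\mathbf{A}}(c,d)$ is the least congruence containing $(c,d)$. $\mathbf{A}$ is congruence orderable if $\Theta_{\mathbf{A}}(1,a)=\Theta_{\mathbf{A}}(1,b)$ implies $a=b$ for $a,b\in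 A$; it is $1$-regular if $1/\alpha=1/\beta$ implies $\alpha=\beta$ for $\alpha,\beta\in\mathsf{Con}(\mathbf{A})$; it is Fregean if it is both. $\mathbf{A}$ is strongly Fregean if every homomorphic image of $\mathbf{A}$ is Fregean (with respect to $1$) and the variety generated by $\mathbf{A}$ is congruence modular. For strongly Fregean $\mathbf{A}$, $\varphi\sim\psi$ implies $\varphi^{+}=\psi^{+}$. For $U=\eta/\!\sim$ and $S\subset U$ put $\overline{S}:=S\cup\{\eta^{+}\}$ (independent of the choice of $\eta\in U$), and for $\varphi,\psi\in\overline{U}$ put $\varphi\bullet\psi:=(\varphi\div\psi)'\cap\eta^{+}$, where $\div$ is symmetric difference and $'$ is complement in $A^2$. Then $(\overline{U},\bullet)$ is a Boolean group (every element is its own inverse) with unit $\eta^{+}$. $Up(\mathsf{Cm}(\mathbf{A}))$ is the family of upward closed subsets of the poset $(\mathsf{Cm}(\mathbf{A}),\le)$. The map $M:\mathsf{Con}(\mathbf{A})\to Up(\mathsf{Cm}(\mathbf{A}))$ is $M(\varphi):=\{\mu\in\mathsf{Cm}(\mathbf{A}):\varphi\le\mu\}$. $\mathcal{S}(\mathbf{A})$ is the set of all $S\in Up(\mathsf{Cm}(\mathbf{A}))$ such that $\overline{S\cap U}$ is a subalgebra of $(\overline{U},\bullet)$ for every $U\in\mathsf{Cm}(\mathbf{A})/\!\sim$. *)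

theory Defs
  imports "HOL-Algebra.Group" "HOL-Library.Countable_Set"
begin

section \<open>Algebras, terms, and varieties\<close>

text \<open>The elements of the type \<^typ>\<open>'f\<close> are the operation symbols of the language; their arities
  are given separately by a function \<open>ar\<close>. The values of an operation on arguments outside the
  carrier, or on lists of the wrong length, are irrelevant.\<close>

record ('a, 'f) ualg = "'a partial_object" +
  ops :: "'f \<Rightarrow> 'a list \<Rightarrow> 'a"

definition ualgebra :: "('f \<Rightarrow> nat) \<Rightarrow> ('a, 'f) ualg \<Rightarrow> bool" where
  "ualgebra ar A \<longleftrightarrow> carrier A \<noteq> {} \<and>
     (\<forall>f xs. length xs = ar f \<and> set xs \<subseteq> carrier A \<longrightarrow> ops A f xs \<in> carrier A)"

datatype 'f trm = Var nat | App 'f "'f trm list"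

fun wf_trm :: "('f \<Rightarrow> nat) \<Rightarrow> 'f trm \<Rightarrow> bool" where
  "wf_trm ar (Var n) \<longleftrightarrow> True"
| "wf_trm ar (App f ts) \<longleftrightarrow> length ts = ar f \<and> (\<forall>t\<in>set ts. wf_trm ar t)"

fun trm_val :: "('a, 'f) ualg \<Rightarrow> (nat \<Rightarrow> 'a) \<Rightarrow> 'f trm \<Rightarrow> 'a" where
  "trm_val A v (Var n) = v n"
| "trm_val A v (App f ts) = ops A f (map (trm_val A v) ts)"

definition satisfies :: "('a, 'f) ualg \<Rightarrow> 'f trm \<Rightarrow> 'f trm \<Rightarrow> bool" where
  "satisfies A s t \<longleftrightarrow> (\<forall>v. range v \<subseteq> carrier A \<longrightarrow> trm_val A v s = trm_val A v t)"

text \<open>A variety is the class of all models of some set of identities, so the least variety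
  containing \<open>A\<close> consists of the models of all identities of \<open>A\<close>.\<close>

definition in_variety :: "('f \<Rightarrow> nat) \<Rightarrow> ('a, 'f) ualg \<Rightarrow> ('b, 'f) ualg \<Rightarrow> bool" where
  "in_variety ar A B \<longleftrightarrow> ualgebra ar B \<and>
     (\<forall>s t. wf_trm ar s \<and> wf_trm ar t \<and> satisfies A s t \<longrightarrow> satisfies B s t)"

definition hom_image :: "('f \<Rightarrow> nat) \<Rightarrow> ('a, 'f) ualg \<Rightarrow> ('b, 'f) ualg \<Rightarrow> bool" where
  "hom_image ar A B \<longleftrightarrow> ualgebra ar B \<and>
     (\<exists>h. h ` carrier A = carrier B \<and>
        (\<forall>f xs. length xs = ar f \<and> set xs \<subseteq> carrier A \<longrightarrow> h (ops A f xs) = ops B f (map h xs)))"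

text \<open>A constant term may contain variables, as long as its value does not depend on them
  (for instance \<open>x \<leftrightarrow> x\<close> in equivalence algebras).\<close>

definition constant_term :: "('f \<Rightarrow> nat) \<Rightarrow> ('a, 'f) ualg \<Rightarrow> 'f trm \<Rightarrow> bool" where
  "constant_term ar A t \<longleftrightarrow> wf_trm ar t \<and>
     (\<forall>v w. range v \<subseteq> carrier A \<and> range w \<subseteq> carrier A \<longrightarrow> trm_val A v t = trm_val A w t)"

definition const_val :: "('a, 'f) ualg \<Rightarrow> 'f trm \<Rightarrow> 'a" where
  "const_val A t = (THE c. \<forall>v. range v \<subseteq> carrier A \<longrightarrow> trm_val A v t = c)"

section \<open>Congruences\<close>

definition Con :: "('f \<Rightarrow> nat) \<Rightarrow> ('a, 'f) ualg \<Rightarrow> ('a \<times> 'a) set set" where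
  "Con ar A = {\<theta>. equiv (carrier A) \<theta> \<and>
     (\<forall>f xs ys. length xs = ar f \<and> list_all2 (\<lambda>x y. (x, y) \<in> \<theta>) xs ys \<longrightarrow>
        (ops A f xs, ops A f ys) \<in> \<theta>)}"

definition Cg :: "('f \<Rightarrow> nat) \<Rightarrow> ('a, 'f) ualg \<Rightarrow> ('a \<times> 'a) set \<Rightarrow> ('a \<times> 'a) set" where
  "Cg ar A X = \<Inter>{\<theta> \<in> Con ar A. X \<subseteq> \<theta>}"

text \<open>Binary meets in \<^term>\<open>Con ar A\<close> are intersections.\<close>

definition join :: "('f \<Rightarrow> nat) \<Rightarrow> ('a, 'f) ualg \<Rightarrow>
    ('a \<times> 'a) set \<Rightarrow> ('a \<times> 'a) set \<Rightarrow> ('a \<times> 'a) set" where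
  "join ar A \<alpha> \<beta> = Cg ar A (\<alpha> \<union> \<beta>)"

definition con_modular :: "('f \<Rightarrow> nat) \<Rightarrow> ('a, 'f) ualg \<Rightarrow> bool" where
  "con_modular ar A \<longleftrightarrow> (\<forall>\<alpha>\<in>Con ar A. \<forall>\<beta>\<in>Con ar A. \<forall>\<gamma>\<in>Con ar A.
     \<alpha> \<subseteq> \<gamma> \<longrightarrow> join ar A \<alpha> (\<beta> \<inter> \<gamma>) = join ar A \<alpha> \<beta> \<inter> \<gamma>)"

text \<open>The meet of the empty family is the full relation, so the latter is not completely
  meet irreducible.\<close>

definition Cm :: "('f \<Rightarrow> nat) \<Rightarrow> ('a, 'f) ualg \<Rightarrow> ('a \<times> 'a) set set" where
  "Cm ar A = {\<eta> \<in> Con ar A.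
     \<forall>F \<subseteq> Con ar A. (carrier A \<times> carrier A) \<inter> \<Inter>F = \<eta> \<longrightarrow> \<eta> \<in> F}"

definition cover :: "('f \<Rightarrow> nat) \<Rightarrow> ('a, 'f) ualg \<Rightarrow> ('a \<times> 'a) set \<Rightarrow> ('a \<times> 'a) set" where
  "cover ar A \<eta> = (LEAST \<theta>. \<theta> \<in> Con ar A \<and> \<eta> \<subset> \<theta>)"

text \<open>The interval \<open>I[\<alpha>, \<beta>]\<close> is represented by the pair \<open>(\<alpha>, \<beta>)\<close>.\<close>

definition transpose_up :: "('f \<Rightarrow> nat) \<Rightarrow> ('a, 'f) ualg \<Rightarrow>
    ((('a \<times> 'a) set \<times> ('a \<times> 'a) set) \<times> (('a \<times> 'a) set \<times> ('a \<times> 'a) set)) set" where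
  "transpose_up ar A = {((\<alpha>, \<beta>), (\<gamma>, \<delta>)).
     {\<alpha>, \<beta>, \<gamma>, \<delta>} \<subseteq> Con ar A \<and> \<alpha> \<subseteq> \<beta> \<and> \<gamma> \<subseteq> \<delta> \<and> \<beta> \<inter> \<gamma> = \<alpha> \<and> join ar A \<beta> \<gamma> = \<delta>}"

definition projective :: "('f \<Rightarrow> nat) \<Rightarrow> ('a, 'f) ualg \<Rightarrow>
    ((('a \<times> 'a) set \<times> ('a \<times> 'a) set) \<times> (('a \<times> 'a) set \<times> ('a \<times> 'a) set)) set" where
  "projective ar A = (transpose_up ar A \<union> (transpose_up ar A)\<inverse>)\<^sup>*"

definition Cm_sim :: "('f \<Rightarrow> nat) \<Rightarrow> ('a, 'f) ualg \<Rightarrow> (('a \<times> 'a) set \<times> ('a \<times> 'a) set) set" where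
  "Cm_sim ar A = {(\<phi>, \<psi>). \<phi> \<in> Cm ar A \<and> \<psi> \<in> Cm ar A \<and>
     ((\<phi>, cover ar A \<phi>), (\<psi>, cover ar A \<psi>)) \<in> projective ar A}"

section \<open>Strongly Fregean algebras\<close>

definition congruence_orderable :: "('f \<Rightarrow> nat) \<Rightarrow> 'f trm \<Rightarrow> ('a, 'f) ualg \<Rightarrow> bool" where
  "congruence_orderable ar t A \<longleftrightarrow> (\<forall>a\<in>carrier A. \<forall>b\<in>carrier A.
     Cg ar A {(const_val A t, a)} = Cg ar A {(const_val A t, b)} \<longrightarrow> a = b)"

definition one_regular :: "('f \<Rightarrow> nat) \<Rightarrow> 'f trm \<Rightarrow> ('a, 'f) ualg \<Rightarrow> bool" where
  "one_regular ar t A \<longleftrightarrow> (\<forall>\<alpha>\<in>Con ar A. \<forall>\<beta>\<in>Con ar A.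
     \<alpha> `` {const_val A t} = \<beta> `` {const_val A t} \<longrightarrow> \<alpha> = \<beta>)"

definition Fregean :: "('f \<Rightarrow> nat) \<Rightarrow> 'f trm \<Rightarrow> ('a, 'f) ualg \<Rightarrow> bool" where
  "Fregean ar t A \<longleftrightarrow> congruence_orderable ar t A \<and> one_regular ar t A"

text \<open>A definition cannot quantify over all types, so homomorphic images are taken with
  carriers in \<^typ>\<open>'a set\<close> (where the quotients of \<open>A\<close> live), and members of the generated variety
  with carriers in \<^typ>\<open>'f trm set\<close> (where all quotients of the term algebra over countably many
  variables live). The theorems \<open>variety_con_modular\<close> and \<open>strongly_Fregean_hom_image\<close> below show
  that this is no restriction.\<close>

definition variety_modular :: "('f \<Rightarrow> nat) \<Rightarrow> ('a, 'f) ualg \<Rightarrow> bool" where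
  "variety_modular ar A \<longleftrightarrow> (\<forall>B :: ('f trm set, 'f) ualg. in_variety ar A B \<longrightarrow> con_modular ar B)"

definition strongly_Fregean :: "('f \<Rightarrow> nat) \<Rightarrow> 'f trm \<Rightarrow> ('a, 'f) ualg \<Rightarrow> bool" where
  "strongly_Fregean ar t A \<longleftrightarrow>
     (\<forall>B :: ('a set, 'f) ualg. hom_image ar A B \<longrightarrow> Fregean ar t B) \<and> variety_modular ar A"

section \<open>The Boolean groups and the map \<open>M\<close>\<close>

definition bar :: "('f \<Rightarrow> nat) \<Rightarrow> ('a, 'f) ualg \<Rightarrow> ('a \<times> 'a) set \<Rightarrow>
    ('a \<times> 'a) set set \<Rightarrow> ('a \<times> 'a) set set" where
  "bar ar A \<eta> S = S \<union> {cover ar A \<eta>}"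

definition bullet :: "('f \<Rightarrow> nat) \<Rightarrow> ('a, 'f) ualg \<Rightarrow> ('a \<times> 'a) set \<Rightarrow>
    ('a \<times> 'a) set \<Rightarrow> ('a \<times> 'a) set \<Rightarrow> ('a \<times> 'a) set" where
  "bullet ar A \<eta> \<phi> \<psi> =
     ((carrier A \<times> carrier A) - ((\<phi> - \<psi>) \<union> (\<psi> - \<phi>))) \<inter> cover ar A \<eta>"

text \<open>In the following two definitions \<open>\<eta>\<close> is a representative of the class \<open>U\<close>; it only enters
  through \<^term>\<open>cover ar A \<eta>\<close>.\<close>

definition bar_group :: "('f \<Rightarrow> nat) \<Rightarrow> ('a, 'f) ualg \<Rightarrow> ('a \<times> 'a) set \<Rightarrow>
    ('a \<times> 'a) set set \<Rightarrow> ('a \<times> 'a) set monoid" where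
  "bar_group ar A \<eta> U =
     \<lparr>carrier = bar ar A \<eta> U, mult = bullet ar A \<eta>, one = cover ar A \<eta>\<rparr>"

definition Up_Cm :: "('f \<Rightarrow> nat) \<Rightarrow> ('a, 'f) ualg \<Rightarrow> ('a \<times> 'a) set set set" where
  "Up_Cm ar A = {S. S \<subseteq> Cm ar A \<and> (\<forall>\<mu>\<in>S. \<forall>\<nu>\<in>Cm ar A. \<mu> \<subseteq> \<nu> \<longrightarrow> \<nu> \<in> S)}"

definition M :: "('f \<Rightarrow> nat) \<Rightarrow> ('a, 'f) ualg \<Rightarrow> ('a \<times> 'a) set \<Rightarrow> ('a \<times> 'a) set set" where
  "M ar A \<phi> = {\<mu> \<in> Cm ar A. \<phi> \<subseteq> \<mu>}"

definition SS :: "('f \<Rightarrow> nat) \<Rightarrow> ('a, 'f) ualg \<Rightarrow> ('a \<times> 'a) set set set" where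
  "SS ar A = {S \<in> Up_Cm ar A. \<forall>U \<in> Cm ar A // Cm_sim ar A. \<forall>\<eta>\<in>U.
     subgroup (bar ar A \<eta> (S \<inter> U)) (bar_group ar A \<eta> U)}"


section \<open>Independence of the chosen carrier types\<close>

definition transport :: "'b set \<Rightarrow> ('b \<Rightarrow> 'c) \<Rightarrow> ('b, 'f) ualg \<Rightarrow> ('c, 'f) ualg" where
  "transport S c B =
     \<lparr>carrier = c ` S, ops = \<lambda>f ys. c (ops B f (map (inv_into S c) ys))\<rparr>"

definition rel_transport :: "'b set \<Rightarrow> ('b \<Rightarrow> 'c) \<Rightarrow> ('b \<times> 'b) set \<Rightarrow> ('c \<times> 'c) set" where
  "rel_transport S c r = {(c x, c y) |x y. x \<in> S \<and> y \<in> S \<and> (x, y) \<in> r}"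

lemma Con_D:
  assumes "\<theta> \<in> Con ar A"
  shows "\<theta> \<subseteq> carrier A \<times> carrier A"
    and "\<And>x. x \<in> carrier A \<Longrightarrow> (x, x) \<in> \<theta>"
    and "\<And>x y. (x, y) \<in> \<theta> \<Longrightarrow> (y, x) \<in> \<theta>"
    and "\<And>x y z. (x, y) \<in> \<theta> \<Longrightarrow> (y, z) \<in> \<theta> \<Longrightarrow> (x, z) \<in> \<theta>"
    and "\<And>f xs ys. length xs = ar f \<Longrightarrow> list_all2 (\<lambda>x y. (x, y) \<in> \<theta>) xs ys \<Longrightarrow>
           (ops A f xs, ops A f ys) \<in> \<theta>"
proof -
  have e: "equiv (carrier A) \<theta>" using assms by (simp add: Con_def)
  show "\<theta> \<subseteq> carrier A \<times> carrier A" "\<And>x. x \<in> carrier A \<Longrightarrow> (x, x) \<in> \<theta>"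
    using e unfolding equiv_def refl_on_def by blast+
  show "\<And>x y. (x, y) \<in> \<theta> \<Longrightarrow> (y, x) \<in> \<theta>" using e by (meson equivE symD)
  show "\<And>x y z. (x, y) \<in> \<theta> \<Longrightarrow> (y, z) \<in> \<theta> \<Longrightarrow> (x, z) \<in> \<theta>" using e by (meson equivE transD)
  show "\<And>f xs ys. length xs = ar f \<Longrightarrow> list_all2 (\<lambda>x y. (x, y) \<in> \<theta>) xs ys \<Longrightarrow>
           (ops A f xs, ops A f ys) \<in> \<theta>"
    using assms unfolding Con_def by blast
qed

lemma Con_I:
  assumes "\<theta> \<subseteq> carrier A \<times> carrier A"
    and "\<And>x. x \<in> carrier A \<Longrightarrow> (x, x) \<in> \<theta>"
    and "\<And>x y. (x, y) \<in> \<theta> \<Longrightarrow> (y, x) \<in> \<theta>"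
    and "\<And>x y z. (x, y) \<in> \<theta> \<Longrightarrow> (y, z) \<in> \<theta> \<Longrightarrow> (x, z) \<in> \<theta>"
    and "\<And>f xs ys. length xs = ar f \<Longrightarrow> list_all2 (\<lambda>x y. (x, y) \<in> \<theta>) xs ys \<Longrightarrow>
           (ops A f xs, ops A f ys) \<in> \<theta>"
  shows "\<theta> \<in> Con ar A"
proof -
  have "sym \<theta>" using assms(3) by (rule symI)
  moreover have "trans \<theta>" using assms(4) by (rule transI)
  ultimately show ?thesis
    using assms(1,2,5) unfolding Con_def equiv_def refl_on_def by blast
qed

lemma Con_full: "ualgebra ar A \<Longrightarrow> carrier A \<times> carrier A \<in> Con ar A"
proof (rule Con_I, goal_cases)
  case (5 f xs ys)
  have "set xs \<subseteq> carrier A" "set ys \<subseteq> carrier A" "length ys = ar f"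
    using 5(2,3) by (auto simp: list_all2_conv_all_nth in_set_conv_nth)
  with 5 show ?case by (auto simp: ualgebra_def)
qed auto

lemma Cg_iff: "(x, y) \<in> Cg ar A X \<longleftrightarrow> (\<forall>\<theta>. \<theta> \<in> Con ar A \<longrightarrow> X \<subseteq> \<theta> \<longrightarrow> (x, y) \<in> \<theta>)"
  unfolding Cg_def Inter_iff mem_Collect_eq by (simp only: imp_conjL Ball_def mem_Collect_eq)

lemma Cg_in_Con:
  assumes A: "ualgebra ar A" and X: "X \<subseteq> carrier A \<times> carrier A"
  shows "Cg ar A X \<in> Con ar A"
proof (rule Con_I)
  show "Cg ar A X \<subseteq> carrier A \<times> carrier A"
    unfolding Cg_def by (rule Inter_lower) (simp add: Con_full[OF A] X)
  show "(x, x) \<in> Cg ar A X" if "x \<in> carrier A" for x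
    unfolding Cg_iff using Con_D(2) that by metis
  show "(y, x) \<in> Cg ar A X" if "(x, y) \<in> Cg ar A X" for x y
    using that Con_D(3) unfolding Cg_iff by metis
  show "(x, z) \<in> Cg ar A X" if "(x, y) \<in> Cg ar A X" "(y, z) \<in> Cg ar A X" for x y z
    unfolding Cg_iff
  proof (intro allI impI)
    fix \<theta> assume t: "\<theta> \<in> Con ar A" "X \<subseteq> \<theta>"
    with that have "(x, y) \<in> \<theta>" "(y, z) \<in> \<theta>" by (simp_all add: Cg_iff)
    then show "(x, z) \<in> \<theta>" by (rule Con_D(4)[OF t(1)])
  qed
  fix f xs ys
  assume xy: "length xs = ar f" "list_all2 (\<lambda>x y. (x, y) \<in> Cg ar A X) xs ys"
  show "(ops A f xs, ops A f ys) \<in> Cg ar A X"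
    unfolding Cg_iff
  proof (intro allI impI)
    fix \<theta> assume t: "\<theta> \<in> Con ar A" "X \<subseteq> \<theta>"
    have "list_all2 (\<lambda>x y. (x, y) \<in> \<theta>) xs ys"
      using xy(2) by (rule list_all2_mono) (use t in \<open>simp add: Cg_iff\<close>)
    then show "(ops A f xs, ops A f ys) \<in> \<theta>" by (rule Con_D(5)[OF t(1) xy(1)])
  qed
qed

lemma Cg_upper: "X \<subseteq> Cg ar A X"
  by (auto simp: Cg_def)

lemma Cg_least: "\<theta> \<in> Con ar A \<Longrightarrow> X \<subseteq> \<theta> \<Longrightarrow> Cg ar A X \<subseteq> \<theta>"
  by (auto simp: Cg_def)

lemma Con_Int: "\<alpha> \<in> Con ar A \<Longrightarrow> \<beta> \<in> Con ar A \<Longrightarrow> \<alpha> \<inter> \<beta> \<in> Con ar A"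
proof (rule Con_I, goal_cases)
  case 1 then show ?case using Con_D(1)[of \<alpha>] by blast
next
  case (2 x) then show ?case using Con_D(2)[of \<alpha>] Con_D(2)[of \<beta>] by blast
next
  case (3 x y) then show ?case using Con_D(3)[of \<alpha>] Con_D(3)[of \<beta>] by blast
next
  case (4 x y z) then show ?case using Con_D(4)[of \<alpha>] Con_D(4)[of \<beta>] by blast
next
  case (5 f xs ys)
  then have "list_all2 (\<lambda>x y. (x, y) \<in> \<alpha>) xs ys" "list_all2 (\<lambda>x y. (x, y) \<in> \<beta>) xs ys"
    by (auto simp: list_all2_conv_all_nth)
  then show ?case using Con_D(5)[OF \<open>\<alpha> \<in> Con ar A\<close>] Con_D(5)[OF \<open>\<beta> \<in> Con ar A\<close>] 5(3) by simp
qed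

lemma list_all2_chain_ops:
  assumes A: "ualgebra ar A" and R: "R \<subseteq> carrier A \<times> carrier A"
    and step: "\<And>us x y vs. length us + 1 + length vs = ar f \<Longrightarrow> set us \<subseteq> carrier A \<Longrightarrow>
       set vs \<subseteq> carrier A \<Longrightarrow> (x, y) \<in> R \<Longrightarrow>
       (ops A f (us @ x # vs), ops A f (us @ y # vs)) \<in> R"
    and xy: "list_all2 (\<lambda>x y. x \<in> carrier A \<and> (x, y) \<in> R\<^sup>*) xs ys"
  shows "set us \<subseteq> carrier A \<Longrightarrow> length us + length xs = ar f \<Longrightarrow>
    (ops A f (us @ xs), ops A f (us @ ys)) \<in> R\<^sup>*"
  using xy
proof (induction arbitrary: us rule: list_all2_induct)
  case Nil then show ?case by simp
next
  case (Cons x xs y ys)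
  have vs: "set xs \<subseteq> carrier A"
    using Cons.hyps by (auto simp: list_all2_conv_all_nth in_set_conv_nth)
  have "(x, y) \<in> R\<^sup>*" using Cons.hyps by auto
  then have 1: "(ops A f (us @ x # xs), ops A f (us @ y # xs)) \<in> R\<^sup>*"
  proof (induction rule: rtrancl_induct)
    case (step z w)
    then have "(ops A f (us @ z # xs), ops A f (us @ w # xs)) \<in> R"
      using assms(3)[of us xs z w] Cons.prems vs by simp
    then show ?case using step by simp
  qed simp
  have y: "y \<in> carrier A"
    using \<open>(x, y) \<in> R\<^sup>*\<close> Cons.hyps R by (metis (no_types, lifting) SigmaD2 rtranclE subsetD)
  have "(ops A f ((us @ [y]) @ xs), ops A f ((us @ [y]) @ ys)) \<in> R\<^sup>*"
    using Cons.IH[of "us @ [y]"] Cons.prems y by simp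
  then have "(ops A f (us @ y # xs), ops A f (us @ y # ys)) \<in> R\<^sup>*" by simp
  with 1 show ?case by (rule rtrancl_trans)
qed

lemma join_subset_rtrancl:
  assumes A: "ualgebra ar A" and ab: "\<alpha> \<in> Con ar A" "\<beta> \<in> Con ar A"
  shows "join ar A \<alpha> \<beta> \<subseteq> (\<alpha> \<union> \<beta>)\<^sup>*"
proof -
  let ?R = "\<alpha> \<union> \<beta>" and ?T = "(\<alpha> \<union> \<beta>)\<^sup>* \<inter> carrier A \<times> carrier A"
  have R: "?R \<subseteq> carrier A \<times> carrier A" using Con_D(1) ab by blast
  have "?T \<in> Con ar A"
  proof (rule Con_I, goal_cases)
    case (3 x y)
    have "sym ?R" using Con_D(3)[OF ab(1)] Con_D(3)[OF ab(2)] by (intro symI) blast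
    then have "sym (?R\<^sup>*)" by (rule sym_rtrancl)
    with 3 show ?case by (auto dest: symD)
  next
    case (5 f xs ys)
    have step: "(ops A f (us @ x # vs), ops A f (us @ y # vs)) \<in> ?R"
      if "length us + 1 + length vs = ar f" "set us \<subseteq> carrier A" "set vs \<subseteq> carrier A"
        "(x, y) \<in> ?R" for us vs x y
    proof -
      have *: "(ops A f (us @ x # vs), ops A f (us @ y # vs)) \<in> \<theta>"
        if t: "\<theta> \<in> Con ar A" and xy: "(x, y) \<in> \<theta>" for \<theta>
      proof (rule Con_D(5)[OF t])
        have "list_all2 (\<lambda>x y. (x, y) \<in> \<theta>) zs zs" if "set zs \<subseteq> carrier A" for zs
          using that Con_D(2)[OF t] by (auto simp: list_all2_same subset_iff)
        then show "list_all2 (\<lambda>x y. (x, y) \<in> \<theta>) (us @ x # vs) (us @ y # vs)"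
          using xy \<open>set us \<subseteq> _\<close> \<open>set vs \<subseteq> _\<close> by (simp add: list_all2_appendI)
      qed (use \<open>length us + 1 + length vs = ar f\<close> in simp)
      show ?thesis using that(4) *[OF ab(1)] *[OF ab(2)] by (elim UnE) simp_all
    qed
    have "list_all2 (\<lambda>x y. x \<in> carrier A \<and> (x, y) \<in> ?R\<^sup>*) xs ys"
      using 5(2) by (auto simp: list_all2_conv_all_nth)
    from list_all2_chain_ops[OF A R step this, of "[]"] 5(1)
    have "(ops A f xs, ops A f ys) \<in> ?R\<^sup>*" by simp
    moreover have "set xs \<subseteq> carrier A" "set ys \<subseteq> carrier A" "length ys = ar f"
      using 5 by (auto simp: list_all2_conv_all_nth in_set_conv_nth)
    ultimately show ?case using A 5(1) by (auto simp: ualgebra_def)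
  qed auto
  moreover have "?R \<subseteq> ?T" using R by auto
  ultimately have "join ar A \<alpha> \<beta> \<subseteq> ?T" unfolding join_def by (rule Cg_least)
  then show ?thesis by blast
qed

lemma rtrancl_finite_path:
  assumes "(x, y) \<in> R\<^sup>*" "R \<subseteq> C \<times> C" "x \<in> C"
  shows "\<exists>F. finite F \<and> x \<in> F \<and> F \<subseteq> C \<and> (x, y) \<in> (R \<inter> F \<times> F)\<^sup>*"
  using assms(1)
proof (induction rule: rtrancl_induct)
  case base
  then show ?case using assms by (intro exI[of _ "{x}"]) auto
next
  case (step y z)
  then obtain F where F: "finite F" "x \<in> F" "F \<subseteq> C" "(x, y) \<in> (R \<inter> F \<times> F)\<^sup>*" by blast
  let ?F = "insert y (insert z F)"
  have "(x, y) \<in> (R \<inter> ?F \<times> ?F)\<^sup>*"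
    by (rule rtrancl_mono[THEN subsetD, OF _ F(4)]) auto
  moreover have "(y, z) \<in> R \<inter> ?F \<times> ?F" using step by auto
  ultimately have "(x, z) \<in> (R \<inter> ?F \<times> ?F)\<^sup>*" by (rule rtrancl_into_rtrancl)
  then show ?case using F step assms by (intro exI[of _ ?F]) auto
qed

context
  fixes ar :: "'f \<Rightarrow> nat" and B :: "('b, 'f) ualg" and S :: "'b set" and c :: "'b \<Rightarrow> 'c"
  assumes B: "ualgebra ar B" and S: "S \<subseteq> carrier B" "S \<noteq> {}"
    and closed: "\<forall>f xs. length xs = ar f \<and> set xs \<subseteq> S \<longrightarrow> ops B f xs \<in> S"
    and inj: "inj_on c S"
begin

lemma transport_ops: "set xs \<subseteq> S \<Longrightarrow> ops (transport S c B) f (map c xs) = c (ops B f xs)"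
proof -
  assume "set xs \<subseteq> S"
  then have "map (inv_into S c) (map c xs) = xs"
    using inj by (auto simp: subset_iff intro!: map_idI)
  then show ?thesis by (simp add: transport_def comp_def)
qed

lemma transport_list:
  assumes "set ys \<subseteq> c ` S" obtains xs where "ys = map c xs" "set xs \<subseteq> S"
proof
  show "ys = map c (map (inv_into S c) ys)"
    using assms by (auto simp: subset_iff f_inv_into_f intro!: map_idI[symmetric])
  show "set (map (inv_into S c) ys) \<subseteq> S" using assms by (auto intro: inv_into_into)
qed

lemma transport_ualgebra: "ualgebra ar (transport S c B)"
proof -
  have "ops (transport S c B) f ys \<in> c ` S" if "length ys = ar f" "set ys \<subseteq> c ` S" for f ys
  proof -
    note ys = that
    obtain xs where xs: "ys = map c xs" "set xs \<subseteq> S" by (rule transport_list[OF ys(2)])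
    then have "ops B f xs \<in> S" using ys(1) closed by simp
    then show ?thesis unfolding xs(1) transport_ops[OF xs(2)] by (rule imageI)
  qed
  with S show ?thesis by (auto simp: ualgebra_def transport_def)
qed

lemma transport_trm_val:
  assumes "range v \<subseteq> S" "wf_trm ar s"
  shows "trm_val B v s \<in> S \<and> trm_val (transport S c B) (c \<circ> v) s = c (trm_val B v s)"
  using assms(2)
proof (induction s)
  case (App f ts)
  then have 1: "set (map (trm_val B v) ts) \<subseteq> S" "length ts = ar f" by auto
  have "trm_val (transport S c B) (c \<circ> v) x = c (trm_val B v x)" if "x \<in> set ts" for x
    using App.IH[OF that] App.prems that unfolding wf_trm.simps by blast
  then have "map (trm_val (transport S c B) (c \<circ> v)) ts = map c (map (trm_val B v) ts)"
    unfolding map_map by (intro map_cong) simp_all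
  then have "trm_val (transport S c B) (c \<circ> v) (App f ts) = c (trm_val B v (App f ts))"
    unfolding trm_val.simps using transport_ops[OF 1(1)] by (simp only:)
  moreover have "trm_val B v (App f ts) \<in> S" using closed 1 by simp
  ultimately show ?case by blast
qed (use assms in auto)

lemma transport_valuation:
  fixes w :: "nat \<Rightarrow> 'c"
  assumes "range w \<subseteq> c ` S" obtains v where "w = c \<circ> v" "range v \<subseteq> S"
proof
  show "w = c \<circ> (inv_into S c \<circ> w)" using assms by (auto simp: fun_eq_iff f_inv_into_f subset_iff)
  show "range (inv_into S c \<circ> w) \<subseteq> S"
    using assms by (simp add: image_subset_iff inv_into_into)
qed

lemma transport_satisfies:
  assumes "wf_trm ar s" "wf_trm ar t" "satisfies B s t"
  shows "satisfies (transport S c B) s t"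
  unfolding satisfies_def
proof safe
  fix w :: "nat \<Rightarrow> 'c" assume "range w \<subseteq> carrier (transport S c B)"
  then have w: "range w \<subseteq> c ` S" by (simp add: transport_def)
  obtain v where v: "w = c \<circ> v" "range v \<subseteq> S" by (rule transport_valuation[OF w])
  have "range v \<subseteq> carrier B" using S(1) by (rule order_trans[OF v(2)])
  then have "trm_val B v s = trm_val B v t" using assms(3) unfolding satisfies_def by blast
  then show "trm_val (transport S c B) w s = trm_val (transport S c B) w t"
    using transport_trm_val[OF v(2) assms(1)] transport_trm_val[OF v(2) assms(2)] v(1) by simp
qed

lemma rel_transport_iff:
  "x \<in> S \<Longrightarrow> y \<in> S \<Longrightarrow> (c x, c y) \<in> rel_transport S c r \<longleftrightarrow> (x, y) \<in> r"
  using inj by (auto simp: rel_transport_def inj_on_def)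

lemma rel_transport_Con:
  assumes "\<theta> \<in> Con ar B" shows "rel_transport S c \<theta> \<in> Con ar (transport S c B)"
proof (rule Con_I, goal_cases)
  case 1 then show ?case by (auto simp: rel_transport_def transport_def)
next
  case (2 x) then show ?case using S Con_D(2)[OF assms] by (auto simp: rel_transport_def transport_def)
next
  case (3 x y) then show ?case using Con_D(3)[OF assms] by (auto simp: rel_transport_def)
next
  case (4 x y z) then show ?case
    using Con_D(4)[OF assms] inj unfolding rel_transport_def inj_on_def by blast
next
  case (5 f ys zs)
  then have "set ys \<subseteq> c ` S" "set zs \<subseteq> c ` S" "length zs = ar f"
    by (fastforce simp: list_all2_conv_all_nth in_set_conv_nth rel_transport_def)+
  obtain ys' where y: "ys = map c ys'" "set ys' \<subseteq> S"
    by (rule transport_list[OF \<open>set ys \<subseteq> c ` S\<close>])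
  obtain zs' where z: "zs = map c zs'" "set zs' \<subseteq> S"
    by (rule transport_list[OF \<open>set zs \<subseteq> c ` S\<close>])
  note yz = y z
  have len: "length ys' = ar f" "length zs' = ar f"
    using 5(1) yz \<open>length zs = ar f\<close> by auto
  have "list_all2 (\<lambda>x y. (x, y) \<in> \<theta>) ys' zs'"
    using 5(2) yz len by (auto simp: list_all2_conv_all_nth rel_transport_iff subset_iff)
  then have "(ops B f ys', ops B f zs') \<in> \<theta>" by (rule Con_D(5)[OF assms len(1)])
  then show ?case using yz len closed by (simp add: transport_ops rel_transport_iff)
qed

lemma transport_modular_witness:
  assumes m: "con_modular ar (transport S c B)"
    and C: "\<alpha> \<in> Con ar B" "\<beta> \<in> Con ar B" "\<gamma> \<in> Con ar B" "\<alpha> \<subseteq> \<gamma>"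
    and xy: "(x, y) \<in> ((\<alpha> \<union> \<beta>) \<inter> S \<times> S)\<^sup>*" "(x, y) \<in> \<gamma>" "x \<in> S"
  shows "(x, y) \<in> join ar B \<alpha> (\<beta> \<inter> \<gamma>)"
proof -
  let ?t = "rel_transport S c" and ?T = "transport S c B"
  note T = transport_ualgebra
  have Ct: "?t \<alpha> \<in> Con ar ?T" "?t \<beta> \<in> Con ar ?T" "?t \<gamma> \<in> Con ar ?T"
    using C by (auto intro: rel_transport_Con)
  have "?t \<alpha> \<union> ?t \<beta> \<subseteq> carrier ?T \<times> carrier ?T" using Ct Con_D(1) by blast
  then have J: "join ar ?T (?t \<alpha>) (?t \<beta>) \<in> Con ar ?T"
    unfolding join_def by (intro Cg_in_Con T)
  have y: "y \<in> S \<and> (c x, c y) \<in> join ar ?T (?t \<alpha>) (?t \<beta>)"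
    using xy(1)
  proof (induction rule: rtrancl_induct)
    case base
    then show ?case using xy(3) Con_D(2)[OF J] by (simp add: transport_def)
  next
    case (step z w)
    then have "(c z, c w) \<in> ?t \<alpha> \<union> ?t \<beta>" by (auto simp: rel_transport_iff)
    then have "(c z, c w) \<in> join ar ?T (?t \<alpha>) (?t \<beta>)" using Cg_upper unfolding join_def by blast
    then show ?case using step Con_D(4)[OF J] by blast
  qed
  then have "(c x, c y) \<in> join ar ?T (?t \<alpha>) (?t \<beta>) \<inter> ?t \<gamma>"
    using xy by (simp add: rel_transport_iff)
  also have "\<dots> = join ar ?T (?t \<alpha>) (?t \<beta> \<inter> ?t \<gamma>)"
  proof -
    have "?t \<alpha> \<subseteq> ?t \<gamma>" using C(4) by (auto simp: rel_transport_def)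
    then show ?thesis using m Ct unfolding con_modular_def by simp
  qed
  also have "\<dots> \<subseteq> ?t (join ar B \<alpha> (\<beta> \<inter> \<gamma>))"
    unfolding join_def[of _ ?T]
  proof (rule Cg_least)
    have "\<alpha> \<union> \<beta> \<inter> \<gamma> \<subseteq> carrier B \<times> carrier B" using C Con_D(1) by blast
    then show "?t (join ar B \<alpha> (\<beta> \<inter> \<gamma>)) \<in> Con ar ?T"
      unfolding join_def by (intro rel_transport_Con Cg_in_Con B)
    have "\<alpha> \<union> \<beta> \<inter> \<gamma> \<subseteq> join ar B \<alpha> (\<beta> \<inter> \<gamma>)" unfolding join_def by (rule Cg_upper)
    then show "?t \<alpha> \<union> ?t \<beta> \<inter> ?t \<gamma> \<subseteq> ?t (join ar B \<alpha> (\<beta> \<inter> \<gamma>))"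
      using inj unfolding rel_transport_def inj_on_def by blast
  qed
  finally show ?thesis using y xy(3) by (simp add: rel_transport_iff)
qed

end

theorem variety_con_modular:
  fixes A :: "('a, 'f) ualg" and B :: "('b, 'f) ualg"
  assumes mod: "variety_modular ar A" and B: "in_variety ar A B"
  shows "con_modular ar B"
  unfolding con_modular_def
proof (intro ballI impI subset_antisym)
  fix \<alpha> \<beta> \<gamma> assume C: "\<alpha> \<in> Con ar B" "\<beta> \<in> Con ar B" "\<gamma> \<in> Con ar B" and ag: "\<alpha> \<subseteq> \<gamma>"
  have UB: "ualgebra ar B" using B by (simp add: in_variety_def)
  have sub: "\<alpha> \<union> \<beta> \<subseteq> carrier B \<times> carrier B" using C Con_D(1) by blast
  have J: "join ar B \<alpha> \<beta> \<in> Con ar B" unfolding join_def by (intro Cg_in_Con UB sub)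
  have "\<alpha> \<union> \<beta> \<inter> \<gamma> \<subseteq> join ar B \<alpha> \<beta> \<inter> \<gamma>"
    using Cg_upper[of "\<alpha> \<union> \<beta>" ar B] ag unfolding join_def by blast
  then show "join ar B \<alpha> (\<beta> \<inter> \<gamma>) \<subseteq> join ar B \<alpha> \<beta> \<inter> \<gamma>"
    unfolding join_def[of _ _ _ "\<beta> \<inter> \<gamma>"] by (intro Cg_least Con_Int J C)
  show "join ar B \<alpha> \<beta> \<inter> \<gamma> \<subseteq> join ar B \<alpha> (\<beta> \<inter> \<gamma>)"
  proof safe
    fix x y assume xy: "(x, y) \<in> join ar B \<alpha> \<beta>" "(x, y) \<in> \<gamma>"
    have x: "x \<in> carrier B" using xy(2) Con_D(1)[OF C(3)] by blast
    have "(x, y) \<in> (\<alpha> \<union> \<beta>)\<^sup>*" using join_subset_rtrancl[OF UB C(1,2)] xy(1) by blast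
    from rtrancl_finite_path[OF this sub x]
    obtain F where F: "finite F" "x \<in> F" "F \<subseteq> carrier B" "(x, y) \<in> ((\<alpha> \<union> \<beta>) \<inter> F \<times> F)\<^sup>*"
      by blast
    define v where "v = from_nat_into F"
    have v: "range v = F"
      unfolding v_def using F by (intro range_from_nat_into) (auto intro: countable_finite)
    define S where "S = trm_val B v ` {s. wf_trm ar s}"
    have FS: "F \<subseteq> S"
    proof
      fix z assume "z \<in> F"
      then obtain n where "z = v n" using v by blast
      then show "z \<in> S" unfolding S_def by (intro image_eqI[of _ _ "Var n"]) auto
    qed
    have closed: "ops B f xs \<in> S" if xs: "length xs = ar f" "set xs \<subseteq> S" for f xs
    proof -
      define g where "g z = (SOME s. wf_trm ar s \<and> trm_val B v s = z)" for z
      have g: "wf_trm ar (g z) \<and> trm_val B v (g z) = z" if "z \<in> S" for z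
        unfolding g_def by (rule someI_ex) (use that S_def in auto)
      have "map (trm_val B v) (map g xs) = xs"
        unfolding map_map by (rule map_idI) (use g xs in auto)
      then have "trm_val B v (App f (map g xs)) = ops B f xs" by (simp del: map_map)
      moreover have "wf_trm ar (App f (map g xs))" using g xs by auto
      ultimately show ?thesis unfolding S_def by (metis image_eqI mem_Collect_eq)
    qed
    have SB: "S \<subseteq> carrier B"
    proof -
      have "wf_trm ar s \<Longrightarrow> trm_val B v s \<in> carrier B" for s
      proof (induction s)
        case (App f ts)
        then have "set (map (trm_val B v) ts) \<subseteq> carrier B" by auto
        with App UB show ?case by (auto simp: ualgebra_def)
      qed (use F v in auto)
      then show ?thesis by (auto simp: S_def)
    qed
    define c where "c z = {s. wf_trm ar s \<and> trm_val B v s = z}" for z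
    have inj: "inj_on c S" unfolding inj_on_def c_def S_def by blast
    have Sne: "S \<noteq> {}" using F FS by blast
    have cl: "\<forall>f xs. length xs = ar f \<and> set xs \<subseteq> S \<longrightarrow> ops B f xs \<in> S" using closed by simp
    note tr = UB SB Sne cl inj
    have "in_variety ar A (transport S c B)"
      using B transport_ualgebra[OF tr] transport_satisfies[OF tr] by (auto simp: in_variety_def)
    then have m: "con_modular ar (transport S c B)" using mod by (auto simp: variety_modular_def)
    have "(x, y) \<in> ((\<alpha> \<union> \<beta>) \<inter> S \<times> S)\<^sup>*"
      by (rule rtrancl_mono[THEN subsetD, OF _ F(4)]) (use FS in auto)
    then show "(x, y) \<in> join ar B \<alpha> (\<beta> \<inter> \<gamma>)"
      using transport_modular_witness[OF tr m C ag _ xy(2)] F FS by blast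
  qed
qed

lemma const_val_eq:
  assumes "constant_term ar A t" "range v \<subseteq> carrier A"
  shows "const_val A t = trm_val A v t"
  unfolding const_val_def using assms unfolding constant_term_def by (intro the_equality) blast+

theorem strongly_Fregean_hom_image:
  fixes A :: "('a, 'f) ualg" and B :: "('b, 'f) ualg"
  assumes A: "ualgebra ar A" "constant_term ar A t" "strongly_Fregean ar t A"
    and hB: "hom_image ar A B"
  shows "Fregean ar t B"
proof -
  obtain h where "h ` carrier A = carrier B \<and>
      (\<forall>f xs. length xs = ar f \<and> set xs \<subseteq> carrier A \<longrightarrow> h (ops A f xs) = ops B f (map h xs))"
    using conjunct2[OF hB[unfolded hom_image_def]] by (rule exE)
  then have h: "h ` carrier A = carrier B"
    "\<And>f xs. length xs = ar f \<Longrightarrow> set xs \<subseteq> carrier A \<Longrightarrow> h (ops A f xs) = ops B f (map h xs)"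
    by simp_all
  have B: "ualgebra ar B" using hB by (simp add: hom_image_def)
  define S where "S = carrier B"
  define c where "c b = {a \<in> carrier A. h a = b}" for b
  define T where "T = transport S c B"
  have inj: "inj_on c S"
  proof (rule inj_onI)
    fix x y assume xy: "x \<in> S" "y \<in> S" "c x = c y"
    then have "x \<in> h ` carrier A" by (simp add: h(1) S_def)
    then obtain a where "a \<in> carrier A" "h a = x" by blast
    then have "a \<in> c y" unfolding xy(3)[symmetric] by (simp add: c_def)
    then show "x = y" using \<open>h a = x\<close> by (simp add: c_def)
  qed
  have SB: "S \<subseteq> carrier B" and Sne: "S \<noteq> {}" using B by (auto simp: S_def ualgebra_def)
  have closed: "\<forall>f xs. length xs = ar f \<and> set xs \<subseteq> S \<longrightarrow> ops B f xs \<in> S"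
    using B by (simp add: S_def ualgebra_def)
  note tr = B SB Sne closed inj
  have UT: "ualgebra ar T" unfolding T_def by (rule transport_ualgebra[OF tr])
  have carT: "carrier T = c ` S" by (simp add: T_def transport_def)
  have "hom_image ar A T"
    unfolding hom_image_def
  proof (intro conjI UT exI[of _ "c \<circ> h"] allI impI)
    show "(c \<circ> h) ` carrier A = carrier T" by (simp add: carT S_def h(1)[symmetric] image_comp)
    fix f and xs :: "'a list" assume xs: "length xs = ar f \<and> set xs \<subseteq> carrier A"
    then have "set (map h xs) \<subseteq> S" using h(1) by (auto simp: S_def)
    then have "ops T f (map c (map h xs)) = c (ops B f (map h xs))"
      unfolding T_def by (rule transport_ops[OF tr])
    then show "(c \<circ> h) (ops A f xs) = ops T f (map (c \<circ> h) xs)" using xs h(2) by simp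
  qed
  then have FT: "Fregean ar t T" using A(3) by (auto simp: strongly_Fregean_def)

  have wf: "wf_trm ar t" using A(2) by (simp add: constant_term_def)
  have hval: "trm_val A v s \<in> carrier A \<and> trm_val B (h \<circ> v) s = h (trm_val A v s)"
    if "range v \<subseteq> carrier A" "wf_trm ar s" for v s
    using that(2)
  proof (induction s)
    case (App f ts)
    then have 1: "set (map (trm_val A v) ts) \<subseteq> carrier A" "length (map (trm_val A v) ts) = ar f"
      by auto
    have "trm_val B (h \<circ> v) x = h (trm_val A v x)" if "x \<in> set ts" for x
      using App.IH[OF that] App.prems that unfolding wf_trm.simps by blast
    then have "map (trm_val B (h \<circ> v)) ts = map h (map (trm_val A v) ts)"
      unfolding map_map by (intro map_cong) simp_all
    then have "trm_val B (h \<circ> v) (App f ts) = h (trm_val A v (App f ts))"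
      unfolding trm_val.simps using h(2)[OF 1(2,1)] by (simp only:)
    moreover have "trm_val A v (App f ts) \<in> carrier A"
      using A(1) 1 unfolding trm_val.simps ualgebra_def by blast
    ultimately show ?case by blast
  qed (use that in auto)
  have lift: "\<exists>v. range v \<subseteq> carrier A \<and> w = h \<circ> v" if "range w \<subseteq> carrier B" for w :: "nat \<Rightarrow> 'b"
  proof (intro exI[of _ "inv_into (carrier A) h \<circ> w"] conjI)
    show "range (inv_into (carrier A) h \<circ> w) \<subseteq> carrier A"
      using that unfolding h(1)[symmetric] by (simp add: image_subset_iff inv_into_into)
    show "w = h \<circ> (inv_into (carrier A) h \<circ> w)"
      using that h(1) by (auto simp: fun_eq_iff f_inv_into_f subset_iff)
  qed
  have cB: "constant_term ar B t"
    unfolding constant_term_def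
  proof (intro conjI wf allI impI)
    fix w w' :: "nat \<Rightarrow> 'b" assume "range w \<subseteq> carrier B \<and> range w' \<subseteq> carrier B"
    then obtain v v' where v: "range v \<subseteq> carrier A" "w = h \<circ> v" "range v' \<subseteq> carrier A" "w' = h \<circ> v'"
      using lift[of w] lift[of w'] by blast
    have "trm_val A v t = trm_val A v' t"
      using A(2) v(1,3) unfolding constant_term_def by blast
    then show "trm_val B w t = trm_val B w' t"
      using hval[OF v(1) wf] hval[OF v(3) wf] v(2,4) by simp
  qed
  obtain v :: "nat \<Rightarrow> 'b" where v: "range v \<subseteq> S"
  proof -
    obtain b where "b \<in> S" using Sne by blast
    then show ?thesis by (intro that[of "\<lambda>_. b"]) auto
  qed
  let ?e = "const_val B t"
  have e: "?e \<in> S \<and> const_val T t = c ?e"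
  proof -
    have 1: "?e = trm_val B v t" using const_val_eq[OF cB] v SB by blast
    have cT: "constant_term ar T t"
      unfolding constant_term_def
    proof (intro conjI wf allI impI)
      fix w w' :: "nat \<Rightarrow> 'a set" assume "range w \<subseteq> carrier T \<and> range w' \<subseteq> carrier T"
      then have w: "range w \<subseteq> c ` S" "range w' \<subseteq> c ` S" by (simp_all add: carT)
      obtain u where u: "w = c \<circ> u" "range u \<subseteq> S" by (rule transport_valuation[OF tr w(1)])
      obtain u' where u': "w' = c \<circ> u'" "range u' \<subseteq> S"
        by (rule transport_valuation[OF tr w(2)])
      have "range u \<subseteq> carrier B \<and> range u' \<subseteq> carrier B" using u(2) u'(2) SB by blast
      then have "trm_val B u t = trm_val B u' t" using cB unfolding constant_term_def by blast
      then show "trm_val T w t = trm_val T w' t"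
        using transport_trm_val[OF tr u(2) wf] transport_trm_val[OF tr u'(2) wf] u(1) u'(1)
        unfolding T_def by simp
    qed
    have "range (c \<circ> v) \<subseteq> carrier T" using v carT by auto
    then have "const_val T t = trm_val T (c \<circ> v) t" by (rule const_val_eq[OF cT])
    then show ?thesis using transport_trm_val[OF tr v wf] 1 unfolding T_def by simp
  qed

  have pre: "{(x, y). x \<in> S \<and> y \<in> S \<and> (c x, c y) \<in> \<psi>} \<in> Con ar B" if P: "\<psi> \<in> Con ar T" for \<psi>
  proof (rule Con_I, goal_cases)
    case (2 x) then show ?case using Con_D(2)[OF P] by (auto simp: carT S_def)
  next
    case (3 x y) then show ?case using Con_D(3)[OF P, of "c x" "c y"] by simp
  next
    case (4 x y z) then show ?case using Con_D(4)[OF P, of "c x" "c y" "c z"] by simp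
  next
    case (5 f xs ys)
    then have s: "set xs \<subseteq> S" "set ys \<subseteq> S" "length ys = ar f"
      by (auto simp: list_all2_conv_all_nth in_set_conv_nth)
    have "list_all2 (\<lambda>x y. (x, y) \<in> \<psi>) (map c xs) (map c ys)"
      using 5(2) by (auto simp: list_all2_conv_all_nth)
    then have "(ops T f (map c xs), ops T f (map c ys)) \<in> \<psi>"
      using Con_D(5)[OF P, of "map c xs" f] 5(1) by simp
    then show ?case using s 5(1) closed by (simp add: T_def transport_ops[OF tr])
  qed (auto simp: S_def)
  have mono: "Cg ar T {(c ?e, c b)} \<subseteq> Cg ar T {(c ?e, c a)}"
    if ab: "a \<in> S" "b \<in> S" "Cg ar B {(?e, a)} = Cg ar B {(?e, b)}" for a b
  proof -
    have "(c ?e, c b) \<in> \<psi>" if P: "\<psi> \<in> Con ar T" "(c ?e, c a) \<in> \<psi>" for \<psi>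
    proof -
      have "Cg ar B {(?e, a)} \<subseteq> {(x, y). x \<in> S \<and> y \<in> S \<and> (c x, c y) \<in> \<psi>}"
        using P ab e by (intro Cg_least pre) auto
      moreover have "(?e, b) \<in> Cg ar B {(?e, a)}" using Cg_upper[of "{(?e, b)}"] ab(3) by blast
      ultimately show ?thesis by blast
    qed
    then have "(c ?e, c b) \<in> Cg ar T {(c ?e, c a)}" by (simp add: Cg_iff)
    moreover have "Cg ar T {(c ?e, c a)} \<in> Con ar T"
      using ab e carT by (intro Cg_in_Con[OF UT]) auto
    ultimately show ?thesis by (intro Cg_least) auto
  qed
  have "congruence_orderable ar t B"
    unfolding congruence_orderable_def
  proof (intro ballI impI)
    fix a b assume ab: "a \<in> carrier B" "b \<in> carrier B" "Cg ar B {(?e, a)} = Cg ar B {(?e, b)}"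
    then have "Cg ar T {(c ?e, c a)} = Cg ar T {(c ?e, c b)}"
      using mono[of a b] mono[of b a] by (auto simp: S_def)
    then have "c a = c b"
      using FT ab e by (auto simp: Fregean_def congruence_orderable_def carT S_def)
    then show "a = b" using inj ab by (auto simp: S_def inj_on_def)
  qed
  moreover have "one_regular ar t B"
    unfolding one_regular_def
  proof (intro ballI impI)
    fix \<alpha> \<beta> assume ab: "\<alpha> \<in> Con ar B" "\<beta> \<in> Con ar B" "\<alpha> `` {?e} = \<beta> `` {?e}"
    let ?r = "rel_transport S c"
    have cls: "?r \<theta> `` {c ?e} = c ` (\<theta> `` {?e})" if "\<theta> \<in> Con ar B" for \<theta>
    proof -
      have "\<theta> `` {?e} \<subseteq> S" using Con_D(1)[OF that] by (auto simp: S_def)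
      then show ?thesis using e inj by (auto simp: rel_transport_def inj_on_def)
    qed
    have "?r \<alpha> = ?r \<beta>"
      using FT rel_transport_Con[OF tr, of \<alpha>] rel_transport_Con[OF tr, of \<beta>] ab cls e
      unfolding Fregean_def one_regular_def T_def[symmetric] by simp
    then have "(x, y) \<in> \<alpha> \<longleftrightarrow> (x, y) \<in> \<beta>" if "x \<in> S" "y \<in> S" for x y
      using rel_transport_iff[OF tr that] by metis
    then show "\<alpha> = \<beta>" using Con_D(1)[OF ab(1)] Con_D(1)[OF ab(2)] by (auto simp: S_def)
  qed
  ultimately show ?thesis by (simp add: Fregean_def)
qed

end

theory Submission
  imports Defs
begin

text \<open>Write \<open>1\<close> for the distinguished constant and \<open>\<eta>\<^sup>+\<close> for the cover of \<open>\<eta>\<close>. Everything rests on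
  one consequence of congruence orderability of the quotients: for a completely meet irreducible
  \<open>\<eta>\<close>, all pairs of \<open>\<eta>\<^sup>+ - \<eta>\<close> lie in the unit class \<open>1/\<eta>\<^sup>+\<close>, and \<open>\<eta>\<close> splits this class into exactly two
  parts (\<open>cover_pairs_in_unit_class\<close>, \<open>cover_unit_class_splits_in_two\<close>). So below \<open>\<eta>\<^sup>+\<close> membership in
  \<open>\<eta>\<close> is a parity condition, and \<open>\<phi> \<bullet> \<psi>\<close> is addition of parities.

  Modularity of the variety enters through \<open>translate_pair\<close>: if \<open>\<beta>\<close> meets \<open>\<phi>\<close> and \<open>\<psi>\<close> in the same
  congruence \<open>\<delta>\<close> and lies below their join, then a pair of \<open>\<beta> - \<delta>\<close> can be moved along \<open>\<phi>\<close>. This is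
  what is left of commutator theory, where \<open>\<beta>\<close> would be abelian over \<open>\<delta>\<close> and centralized by \<open>\<phi>\<close>; a
  Day term (\<open>day_function\<close>) takes the part of the difference term. If \<open>\<phi> \<noteq> \<psi>\<close> are completely meet
  irreducible and \<open>I[\<delta>, \<beta>]\<close> transposes up to the covers of both, then the pairs moved from \<open>1\<close> to
  the members \<open>x\<close> of \<open>1/\<phi>\<close> belong to \<open>\<psi>\<^sup>+ - \<psi>\<close>, whence \<open>x \<in> 1/\<psi>\<^sup>+\<close>. By 1-regularity \<open>\<phi> \<subseteq> \<psi>\<^sup>+\<close>, and by
  symmetry \<open>\<phi>\<^sup>+ = \<psi>\<^sup>+\<close>.

  Along such steps congruence-preserving unary functions act in the same way on the two parts of
  the unit class. This relation \<open>alike\<close> is an equivalence, so it is implied by \<open>\<sim>\<close>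
  (\<open>Cm_sim_imp_alike\<close>), and it makes \<open>\<phi> \<bullet> \<psi>\<close> a congruence. A second translation shows that
  \<open>\<phi> \<bullet> \<psi>\<close> is completely meet irreducible with the same cover, and it is in the class of \<open>\<phi>\<close>
  (\<open>bullet_in_Cm\<close>). Since \<open>\<theta> \<subseteq> \<phi>, \<psi>\<close> clearly gives \<open>\<theta> \<subseteq> \<phi> \<bullet> \<psi>\<close>, the sets \<open>M \<theta>\<close> are in \<open>\<S>\<close>.

  Injectivity of \<open>M\<close> holds as every congruence is a meet of completely meet irreducible ones. For
  surjectivity, with \<open>A\<close> finite, the point is that \<open>\<Inter>S \<subseteq> \<mu>\<close> implies \<open>\<mu> \<in> S\<close> for \<open>S \<in> \<S>\<close>. If \<open>\<phi>\<close> is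
  minimal in \<open>S\<close> and cannot be omitted from the meet, then \<open>\<phi> \<sim> \<mu>\<close> by modularity, and \<open>\<phi> \<bullet> \<mu>\<close>
  lies above the meet of the remaining elements; by induction \<open>\<phi> \<bullet> \<mu> \<in> S\<close>, and hence
  \<open>\<mu> = (\<phi> \<bullet> \<mu>) \<bullet> \<phi> \<in> S\<close> (\<open>SS_contains_above_meet\<close>).\<close>

section \<open>Congruences\<close>

lemma Con_Inter:
  assumes "ualgebra ar A" "F \<subseteq> Con ar A"
  shows "(carrier A \<times> carrier A) \<inter> \<Inter>F \<in> Con ar A"
proof (cases "F = {}")
  case True
  then show ?thesis using Con_full[OF assms(1)] by simp
next
  case False
  then have "(carrier A \<times> carrier A) \<inter> \<Inter>F = Cg ar A ((carrier A \<times> carrier A) \<inter> \<Inter>F)"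
    using assms(2) Con_D(1) unfolding Cg_def by blast
  then show ?thesis using Cg_in_Con[OF assms(1)] by (metis inf_le1)
qed

text \<open>A map on the carrier that respects every congruence stands in for a unary polynomial:
  unlike polynomials, such maps need no term for their description.\<close>

definition congruence_preserving :: "('f \<Rightarrow> nat) \<Rightarrow> ('a, 'f) ualg \<Rightarrow> ('a \<Rightarrow> 'a) \<Rightarrow> bool" where
  "congruence_preserving ar A p \<longleftrightarrow> (\<forall>\<theta>\<in>Con ar A. \<forall>(x, y)\<in>\<theta>. (p x, p y) \<in> \<theta>)"

lemma congruence_preservingD:
  "congruence_preserving ar A p \<Longrightarrow> \<theta> \<in> Con ar A \<Longrightarrow> (x, y) \<in> \<theta> \<Longrightarrow> (p x, p y) \<in> \<theta>"
  by (auto simp: congruence_preserving_def)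

lemma congruence_preserving_translation:
  assumes "length us + 1 + length vs = ar f" "set us \<subseteq> carrier A" "set vs \<subseteq> carrier A"
  shows "congruence_preserving ar A (\<lambda>z. ops A f (us @ z # vs))"
  unfolding congruence_preserving_def
proof (intro ballI, clarify)
  fix \<theta> x y assume t: "\<theta> \<in> Con ar A" "(x, y) \<in> \<theta>"
  have "list_all2 (\<lambda>x y. (x, y) \<in> \<theta>) zs zs" if "set zs \<subseteq> carrier A" for zs
    using that Con_D(2)[OF t(1)] by (auto simp: list_all2_same subset_iff)
  then have "list_all2 (\<lambda>x y. (x, y) \<in> \<theta>) (us @ x # vs) (us @ y # vs)"
    using t(2) assms by (simp add: list_all2_appendI)
  then show "(ops A f (us @ x # vs), ops A f (us @ y # vs)) \<in> \<theta>"
    using assms(1) by (intro Con_D(5)[OF t(1)]) simp_all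
qed

lemma Con_I_translations:
  assumes A: "ualgebra ar A" and e: "equiv (carrier A) \<theta>"
    and p: "\<And>p x y. congruence_preserving ar A p \<Longrightarrow> (x, y) \<in> \<theta> \<Longrightarrow> (p x, p y) \<in> \<theta>"
  shows "\<theta> \<in> Con ar A"
  unfolding Con_def
proof (intro CollectI conjI e allI impI, elim conjE)
  fix f xs ys assume xy: "length xs = ar f" "list_all2 (\<lambda>x y. (x, y) \<in> \<theta>) xs ys"
  have sub: "\<theta> \<subseteq> carrier A \<times> carrier A"
    and refl: "\<And>x. x \<in> carrier A \<Longrightarrow> (x, x) \<in> \<theta>"
    and tr: "trans \<theta>"
    using e by (auto simp: equiv_def refl_on_def)
  have "list_all2 (\<lambda>x y. x \<in> carrier A \<and> (x, y) \<in> \<theta>\<^sup>*) xs ys"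
    using xy(2) by (rule list_all2_mono) (use sub in auto)
  moreover have "(ops A f (us @ x # vs), ops A f (us @ y # vs)) \<in> \<theta>"
    if "length us + 1 + length vs = ar f" "set us \<subseteq> carrier A" "set vs \<subseteq> carrier A"
      "(x, y) \<in> \<theta>" for us vs x y
    by (rule p[OF congruence_preserving_translation that(4)]) (use that in simp_all)
  ultimately have "(ops A f ([] @ xs), ops A f ([] @ ys)) \<in> \<theta>\<^sup>*"
    using xy(1) by (intro list_all2_chain_ops[OF A sub]) simp_all
  then have "(ops A f xs, ops A f ys) \<in> \<theta> \<or> ops A f xs = ops A f ys"
    using tr by (metis rtranclD trancl_id append_Nil)
  moreover have "set xs \<subseteq> carrier A"
    using xy(2) sub by (fastforce simp: list_all2_conv_all_nth in_set_conv_nth)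
  then have "ops A f xs \<in> carrier A" using A xy(1) by (simp add: ualgebra_def)
  ultimately show "(ops A f xs, ops A f ys) \<in> \<theta>" using refl by metis
qed

lemma join_upper1: "\<alpha> \<subseteq> join ar A \<alpha> \<beta>" and join_upper2: "\<beta> \<subseteq> join ar A \<alpha> \<beta>"
  using Cg_upper[of "\<alpha> \<union> \<beta>" ar A] by (auto simp: join_def)

lemma join_least: "\<theta> \<in> Con ar A \<Longrightarrow> \<alpha> \<subseteq> \<theta> \<Longrightarrow> \<beta> \<subseteq> \<theta> \<Longrightarrow> join ar A \<alpha> \<beta> \<subseteq> \<theta>"
  unfolding join_def by (intro Cg_least) auto

lemma join_commute: "join ar A \<alpha> \<beta> = join ar A \<beta> \<alpha>"
  by (simp add: join_def Un_commute)

lemma join_in_Con: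
  "ualgebra ar A \<Longrightarrow> \<alpha> \<in> Con ar A \<Longrightarrow> \<beta> \<in> Con ar A \<Longrightarrow> join ar A \<alpha> \<beta> \<in> Con ar A"
  unfolding join_def by (intro Cg_in_Con Un_least Con_D(1))

lemma join_absorb: "\<beta> \<in> Con ar A \<Longrightarrow> \<alpha> \<subseteq> \<beta> \<Longrightarrow> join ar A \<beta> \<alpha> = \<beta>"
  by (rule subset_antisym[OF join_least join_upper1]) simp_all

section \<open>Completely meet irreducible congruences\<close>

lemma cover_eqI:
  assumes "\<alpha> \<in> Con ar A" "\<eta> \<subset> \<alpha>" "\<And>\<theta>. \<theta> \<in> Con ar A \<Longrightarrow> \<eta> \<subset> \<theta> \<Longrightarrow> \<alpha> \<subseteq> \<theta>"
  shows "cover ar A \<eta> = \<alpha>"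
  unfolding cover_def using assms by (intro Least_equality) auto

lemma Cm_I:
  assumes "\<eta> \<in> Con ar A" "\<eta> \<subset> \<alpha>" "\<alpha> \<in> Con ar A"
    "\<And>\<theta>. \<theta> \<in> Con ar A \<Longrightarrow> \<eta> \<subset> \<theta> \<Longrightarrow> \<alpha> \<subseteq> \<theta>"
  shows "\<eta> \<in> Cm ar A"
proof -
  have "\<eta> \<in> F" if F: "F \<subseteq> Con ar A" "(carrier A \<times> carrier A) \<inter> \<Inter>F = \<eta>" for F
  proof (rule ccontr)
    assume "\<eta> \<notin> F"
    then have "\<alpha> \<subseteq> \<theta>" if "\<theta> \<in> F" for \<theta> using that assms(4)[of \<theta>] F by blast
    then have "\<alpha> \<subseteq> \<Inter>F" by (rule Inter_greatest)
    then show False using F(2) assms(2) Con_D(1)[OF assms(3)] by auto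
  qed
  then show ?thesis using assms(1) by (simp add: Cm_def)
qed

lemma Cm_Con: "\<eta> \<in> Cm ar A \<Longrightarrow> \<eta> \<in> Con ar A"
  by (simp add: Cm_def)

lemma
  assumes A: "ualgebra ar A" and \<eta>: "\<eta> \<in> Cm ar A"
  shows cover_Con: "cover ar A \<eta> \<in> Con ar A"
    and cover_above: "\<eta> \<subset> cover ar A \<eta>"
    and cover_least: "\<And>\<theta>. \<theta> \<in> Con ar A \<Longrightarrow> \<eta> \<subset> \<theta> \<Longrightarrow> cover ar A \<eta> \<subseteq> \<theta>"
proof -
  define F where "F = {\<theta> \<in> Con ar A. \<eta> \<subset> \<theta>}"
  define \<alpha> where "\<alpha> = (carrier A \<times> carrier A) \<inter> \<Inter>F"
  have "F \<subseteq> Con ar A" "\<eta> \<notin> F" by (auto simp: F_def)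
  then have 1: "\<alpha> \<in> Con ar A" "\<alpha> \<noteq> \<eta>"
    using \<eta> Con_Inter[OF A] by (auto simp: \<alpha>_def Cm_def)
  have "\<eta> \<subseteq> \<alpha>" using Con_D(1)[OF Cm_Con[OF \<eta>]] by (auto simp: \<alpha>_def F_def)
  moreover have 2: "\<And>\<theta>. \<theta> \<in> Con ar A \<Longrightarrow> \<eta> \<subset> \<theta> \<Longrightarrow> \<alpha> \<subseteq> \<theta>" by (auto simp: \<alpha>_def F_def)
  ultimately have "cover ar A \<eta> = \<alpha>" using 1 by (intro cover_eqI) auto
  then show "cover ar A \<eta> \<in> Con ar A" "\<eta> \<subset> cover ar A \<eta>"
    "\<And>\<theta>. \<theta> \<in> Con ar A \<Longrightarrow> \<eta> \<subset> \<theta> \<Longrightarrow> cover ar A \<eta> \<subseteq> \<theta>"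
    using 1 2 \<open>\<eta> \<subseteq> \<alpha>\<close> by auto
qed

lemma Con_chain_Union:
  assumes "subset.chain (Con ar A) K" "K \<noteq> {}"
  shows "\<Union>K \<in> Con ar A"
proof -
  have K: "K \<subseteq> Con ar A" and ch: "\<And>\<alpha> \<beta>. \<alpha> \<in> K \<Longrightarrow> \<beta> \<in> K \<Longrightarrow> \<alpha> \<subseteq> \<beta> \<or> \<beta> \<subseteq> \<alpha>"
    using assms(1) by (auto simp: subset_chain_def)
  obtain \<kappa> where \<kappa>: "\<kappa> \<in> K" using assms(2) by blast
  show ?thesis
  proof (rule Con_I, goal_cases)
    case 1
    show ?case by (intro Union_least) (rule Con_D(1)[OF subsetD[OF K]])
  next
    case (2 x)
    then have "(x, x) \<in> \<kappa>" using K \<kappa> by (intro Con_D(2)[of \<kappa> ar A]) auto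
    then show ?case using \<kappa> by blast
  next
    case (3 x y)
    then obtain \<alpha> where "\<alpha> \<in> K" "(x, y) \<in> \<alpha>" by blast
    then show ?case using Con_D(3)[of \<alpha> ar A x y] K by blast
  next
    case (4 x y z)
    then obtain \<alpha> \<beta> where ab: "\<alpha> \<in> K" "(x, y) \<in> \<alpha>" "\<beta> \<in> K" "(y, z) \<in> \<beta>" by blast
    obtain \<gamma> where \<gamma>: "\<gamma> \<in> K" "\<alpha> \<subseteq> \<gamma>" "\<beta> \<subseteq> \<gamma>" using ch[OF ab(1,3)] ab by blast
    then have "(x, z) \<in> \<gamma>" using ab K by (intro Con_D(4)[of \<gamma> ar A x y z]) auto
    then show ?case using \<gamma> by blast
  next
    case (5 f xs ys)
    have "\<exists>\<alpha>\<in>K. list_all2 (\<lambda>x y. (x, y) \<in> \<alpha>) xs ys"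
      using 5(2)
    proof (induction rule: list_all2_induct)
      case Nil then show ?case using \<kappa> by auto
    next
      case (Cons x xs y ys)
      then obtain \<alpha> \<beta> where ab: "\<alpha> \<in> K" "list_all2 (\<lambda>x y. (x, y) \<in> \<alpha>) xs ys" "\<beta> \<in> K" "(x, y) \<in> \<beta>"
        by blast
      obtain \<gamma> where "\<gamma> \<in> K" "\<alpha> \<subseteq> \<gamma>" "\<beta> \<subseteq> \<gamma>" using ch[OF ab(1,3)] ab by blast
      moreover from this have "list_all2 (\<lambda>x y. (x, y) \<in> \<gamma>) xs ys"
        using ab(2) by (elim list_all2_mono) blast
      ultimately show ?case using ab by (intro bexI[of _ \<gamma>]) auto
    qed
    then obtain \<alpha> where \<alpha>: "\<alpha> \<in> K" "list_all2 (\<lambda>x y. (x, y) \<in> \<alpha>) xs ys" by blast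
    then have "(ops A f xs, ops A f ys) \<in> \<alpha>" using 5(1) K by (intro Con_D(5)[of \<alpha> ar A]) auto
    then show ?case using \<alpha>(1) by blast
  qed
qed

text \<open>Congruences form an algebraic lattice, so each of them is a meet of completely meet
  irreducible ones: a congruence maximal among those that omit a given pair is of this kind.\<close>

lemma Cm_separates:
  assumes A: "ualgebra ar A" and \<theta>: "\<theta> \<in> Con ar A"
    and uv: "(u, v) \<notin> \<theta>" "u \<in> carrier A" "v \<in> carrier A"
  obtains \<eta> where "\<eta> \<in> Cm ar A" "\<theta> \<subseteq> \<eta>" "(u, v) \<notin> \<eta>"
proof -
  define P where "P = {\<eta> \<in> Con ar A. \<theta> \<subseteq> \<eta> \<and> (u, v) \<notin> \<eta>}"
  have "\<exists>m\<in>P. \<forall>x\<in>P. m \<subseteq> x \<longrightarrow> x = m"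
  proof (rule subset_Zorn_nonempty)
    show "P \<noteq> {}" using \<theta> uv by (auto simp: P_def)
    fix K assume K: "K \<noteq> {}" "subset.chain P K"
    then have "subset.chain (Con ar A) K" by (auto simp: P_def subset_chain_def)
    then have "\<Union>K \<in> Con ar A" using K(1) by (rule Con_chain_Union)
    then show "\<Union>K \<in> P" using K by (auto simp: P_def subset_chain_def)
  qed
  then obtain \<eta> where \<eta>: "\<eta> \<in> P" "\<And>x. x \<in> P \<Longrightarrow> \<eta> \<subseteq> x \<Longrightarrow> x = \<eta>" by blast
  define \<alpha> where "\<alpha> = Cg ar A (insert (u, v) \<eta>)"
  have \<eta>C: "\<eta> \<in> Con ar A" "\<theta> \<subseteq> \<eta>" "(u, v) \<notin> \<eta>" using \<eta>(1) by (auto simp: P_def)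
  have "insert (u, v) \<eta> \<subseteq> carrier A \<times> carrier A" using uv Con_D(1)[OF \<eta>C(1)] by auto
  then have "\<alpha> \<in> Con ar A" unfolding \<alpha>_def by (rule Cg_in_Con[OF A])
  moreover have "\<eta> \<subset> \<alpha>" using Cg_upper[of "insert (u, v) \<eta>" ar A] \<eta>C unfolding \<alpha>_def by auto
  moreover have "\<alpha> \<subseteq> \<chi>" if "\<chi> \<in> Con ar A" "\<eta> \<subset> \<chi>" for \<chi>
  proof -
    have "(u, v) \<in> \<chi>" using \<eta>(2)[of \<chi>] that \<eta>C by (auto simp: P_def)
    then show ?thesis unfolding \<alpha>_def using that by (intro Cg_least) auto
  qed
  ultimately have "\<eta> \<in> Cm ar A" using \<eta>C by (intro Cm_I) auto
  then show ?thesis using that \<eta>C by blast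
qed

section \<open>Modular varieties\<close>

text \<open>Identities hold in a subalgebra of a power because terms are evaluated one coordinate at a
  time.\<close>

lemma in_variety_subpower:
  fixes A :: "('a, 'f) ualg" and B :: "('i \<Rightarrow> 'a, 'f) ualg"
  assumes B: "ualgebra ar B" and sub: "carrier B \<subseteq> I \<rightarrow>\<^sub>E carrier A"
    and ops: "\<And>f es. ops B f es = (\<lambda>i\<in>I. ops A f (map (\<lambda>e. e i) es))"
  shows "in_variety ar A B"
proof -
  have val: "trm_val B w s = (\<lambda>i\<in>I. trm_val A (\<lambda>n. w n i) s)" if "range w \<subseteq> carrier B" for w s
  proof (induction s)
    case (Var n)
    have "w n \<in> I \<rightarrow>\<^sub>E carrier A" using that sub by blast
    then show ?case by (simp add: PiE_restrict)
  next
    case (App f ts)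
    have "map (\<lambda>e. e i) (map (trm_val B w) ts) = map (trm_val A (\<lambda>n. w n i)) ts" if "i \<in> I" for i
      using App that by simp
    then show ?case unfolding trm_val.simps ops by (intro restrict_ext) (simp only:)
  qed
  have "satisfies B s t" if st: "satisfies A s t" for s t
    unfolding satisfies_def
  proof (intro allI impI)
    fix w :: "nat \<Rightarrow> 'i \<Rightarrow> 'a" assume w: "range w \<subseteq> carrier B"
    have "trm_val A (\<lambda>n. w n i) s = trm_val A (\<lambda>n. w n i) t" if "i \<in> I" for i
    proof -
      have "range (\<lambda>n. w n i) \<subseteq> carrier A" using w sub that by fastforce
      then show ?thesis using st by (simp add: satisfies_def)
    qed
    then show "trm_val B w s = trm_val B w t" unfolding val[OF w] by (intro restrict_ext)
  qed
  then show ?thesis using B by (simp add: in_variety_def)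
qed

text \<open>The quaternary congruence-preserving functions of \<open>A\<close> take the place of the free algebra on
  four generators.\<close>

definition quaternary_clone :: "('f \<Rightarrow> nat) \<Rightarrow> ('a, 'f) ualg \<Rightarrow> ('a \<times> 'a \<times> 'a \<times> 'a \<Rightarrow> 'a, 'f) ualg"
  where "quaternary_clone ar A =
    (let I = carrier A \<times> carrier A \<times> carrier A \<times> carrier A in
     \<lparr>carrier = {m \<in> I \<rightarrow>\<^sub>E carrier A. \<forall>\<theta>\<in>Con ar A. \<forall>x y z u x' y' z' u'.
        (x, x') \<in> \<theta> \<and> (y, y') \<in> \<theta> \<and> (z, z') \<in> \<theta> \<and> (u, u') \<in> \<theta> \<longrightarrow>
        (m (x, y, z, u), m (x', y', z', u')) \<in> \<theta>},
      ops = \<lambda>f es. \<lambda>i\<in>I. ops A f (map (\<lambda>e. e i) es)\<rparr>)"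

lemma quaternary_clone_preserves:
  assumes "m \<in> carrier (quaternary_clone ar A)" "\<theta> \<in> Con ar A"
    "(x, x') \<in> \<theta>" "(y, y') \<in> \<theta>" "(z, z') \<in> \<theta>" "(u, u') \<in> \<theta>"
  shows "(m (x, y, z, u), m (x', y', z', u')) \<in> \<theta>"
  using assms unfolding quaternary_clone_def Let_def by simp

lemma quaternary_cloneI:
  assumes A: "ualgebra ar A"
    and m: "\<And>\<theta> x y z u x' y' z' u'. \<theta> \<in> Con ar A \<Longrightarrow> (x, x') \<in> \<theta> \<Longrightarrow> (y, y') \<in> \<theta> \<Longrightarrow>
      (z, z') \<in> \<theta> \<Longrightarrow> (u, u') \<in> \<theta> \<Longrightarrow> (m (x, y, z, u), m (x', y', z', u')) \<in> \<theta>"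
  shows "restrict m (carrier A \<times> carrier A \<times> carrier A \<times> carrier A) \<in> carrier (quaternary_clone ar A)"
    (is "restrict m ?I \<in> _")
proof -
  have "m (x, y, z, u) \<in> carrier A" if "(x, y, z, u) \<in> ?I" for x y z u
    using m[OF Con_full[OF A], of x x y y z z u u] that by simp
  then have 1: "restrict m ?I \<in> ?I \<rightarrow>\<^sub>E carrier A"
    unfolding restrict_PiE by (intro Pi_I) (elim SigmaE, simp)
  have 2: "(restrict m ?I (x, y, z, u), restrict m ?I (x', y', z', u')) \<in> \<theta>"
    if t: "\<theta> \<in> Con ar A"
      and r: "(x, x') \<in> \<theta> \<and> (y, y') \<in> \<theta> \<and> (z, z') \<in> \<theta> \<and> (u, u') \<in> \<theta>"
    for \<theta> x y z u x' y' z' u'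
  proof -
    have "p \<in> carrier A \<and> q \<in> carrier A" if "(p, q) \<in> \<theta>" for p q
      using that Con_D(1)[OF t] by blast
    then have "(x, y, z, u) \<in> ?I" "(x', y', z', u') \<in> ?I" using r by (simp_all; blast)+
    then show ?thesis using m[OF t] r by (simp only: restrict_apply')
  qed
  show ?thesis
    unfolding quaternary_clone_def Let_def partial_object.simps
    by (intro CollectI conjI 1 ballI allI impI) (rule 2)
qed

lemma quaternary_clone_funcset:
  "carrier (quaternary_clone ar A) \<subseteq>
    carrier A \<times> carrier A \<times> carrier A \<times> carrier A \<rightarrow>\<^sub>E carrier A"
  unfolding quaternary_clone_def Let_def partial_object.simps by (rule Collect_restrict)

lemma quaternary_clone_val:
  assumes "m \<in> carrier (quaternary_clone ar A)" "x \<in> carrier A" "y \<in> carrier A" "z \<in> carrier A"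
    "u \<in> carrier A"
  shows "m (x, y, z, u) \<in> carrier A"
  by (rule PiE_mem[OF subsetD[OF quaternary_clone_funcset assms(1)]]) (simp add: assms)

lemma ops_quaternary_clone:
  "ops (quaternary_clone ar A) f es =
    (\<lambda>i\<in>carrier A \<times> carrier A \<times> carrier A \<times> carrier A. ops A f (map (\<lambda>e. e i) es))"
  by (simp add: quaternary_clone_def Let_def)

lemma ualgebra_quaternary_clone:
  assumes A: "ualgebra ar A" shows "ualgebra ar (quaternary_clone ar A)"
proof -
  let ?Q = "quaternary_clone ar A"
  have "restrict fst (carrier A \<times> carrier A \<times> carrier A \<times> carrier A) \<in> carrier ?Q"
    by (rule quaternary_cloneI[OF A]) simp
  moreover have "ops ?Q f es \<in> carrier ?Q" if es: "length es = ar f" "set es \<subseteq> carrier ?Q" for f es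
    unfolding ops_quaternary_clone
  proof (rule quaternary_cloneI[OF A])
    fix \<theta> x y z u x' y' z' u'
    assume t: "\<theta> \<in> Con ar A" "(x, x') \<in> \<theta>" "(y, y') \<in> \<theta>" "(z, z') \<in> \<theta>" "(u, u') \<in> \<theta>"
    have "(e (x, y, z, u), e (x', y', z', u')) \<in> \<theta>" if "e \<in> set es" for e
      using quaternary_clone_preserves[OF _ t] that es(2) by blast
    then have "list_all2 (\<lambda>x y. (x, y) \<in> \<theta>) (map (\<lambda>e. e (x, y, z, u)) es) (map (\<lambda>e. e (x', y', z', u')) es)"
      by (simp add: list_all2_conv_all_nth)
    then show "(ops A f (map (\<lambda>e. e (x, y, z, u)) es), ops A f (map (\<lambda>e. e (x', y', z', u')) es)) \<in> \<theta>"
      using es(1) by (intro Con_D(5)[OF t(1)]) simp_all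
  qed
  ultimately show ?thesis unfolding ualgebra_def by auto
qed

locale modular_algebra =
  fixes ar :: "'f \<Rightarrow> nat" and A :: "('a, 'f) ualg"
  assumes alg: "ualgebra ar A" and variety_modular: "variety_modular ar A"
begin

lemma con_modular: "con_modular ar A"
  by (rule variety_con_modular[OF variety_modular]) (simp add: in_variety_def alg)

lemma modular_law:
  assumes "\<alpha> \<in> Con ar A" "\<beta> \<in> Con ar A" "\<gamma> \<in> Con ar A" "\<alpha> \<subseteq> \<gamma>"
  shows "join ar A \<alpha> (\<beta> \<inter> \<gamma>) = join ar A \<alpha> \<beta> \<inter> \<gamma>"
  using con_modular assms by (auto simp: con_modular_def)

text \<open>This is Day's description of modularity, with congruence-preserving functions for terms. In
  the congruence lattice of the clone, let \<open>\<alpha>\<close>, \<open>\<beta>\<close>, \<open>\<gamma>\<close> be equality at all arguments of the forms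
  \<open>(x, y, y, x)\<close>, \<open>(x, x, z, z)\<close>, \<open>(x, y, y, u)\<close>. By \<open>\<gamma> \<subseteq> \<alpha>\<close> and the modular law, the first and the
  last projection are linked by a chain of \<open>\<gamma>\<close>- and \<open>(\<beta> \<inter> \<alpha>)\<close>-steps. If no function \<open>m\<close> on the
  chain distinguished \<open>(a, a, c, c)\<close> from \<open>(a, b, b, c)\<close> modulo \<open>\<theta>\<close>, then the value at
  \<open>(a, b, b, c)\<close> would stay the same modulo \<open>\<theta>\<close> all the way from \<open>a\<close> to \<open>c\<close>.\<close>

lemma day_function:
  assumes \<theta>: "\<theta> \<in> Con ar A" and abc: "a \<in> carrier A" "b \<in> carrier A" "c \<in> carrier A"
    and ac: "(a, c) \<notin> \<theta>"
  obtains m where "m \<in> carrier (quaternary_clone ar A)"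
    "\<And>x y. x \<in> carrier A \<Longrightarrow> y \<in> carrier A \<Longrightarrow> m (x, y, y, x) = x"
    "(m (a, a, c, c), m (a, b, b, c)) \<notin> \<theta>"
proof (rule ccontr)
  assume no: "\<not> thesis"
  note distinguishing = that
  let ?Q = "quaternary_clone ar A" and ?C = "carrier A"
  let ?I = "?C \<times> ?C \<times> ?C \<times> ?C"
  have Q: "ualgebra ar ?Q" by (rule ualgebra_quaternary_clone[OF alg])
  have "in_variety ar A ?Q"
    by (rule in_variety_subpower[OF Q quaternary_clone_funcset ops_quaternary_clone])
  then have mod: "con_modular ar ?Q" by (rule variety_con_modular[OF variety_modular])
  define K where "K J = {(e, e'). e \<in> carrier ?Q \<and> e' \<in> carrier ?Q \<and> (\<forall>i\<in>J. e i = e' i)}" for J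
  have K: "K J \<in> Con ar ?Q" if J: "J \<subseteq> ?I" for J
  proof (rule Con_I)
    fix f xs ys assume xy: "length xs = ar f" "list_all2 (\<lambda>x y. (x, y) \<in> K J) xs ys"
    then have "set xs \<subseteq> carrier ?Q" "set ys \<subseteq> carrier ?Q" "length ys = ar f"
      by (auto simp: list_all2_conv_all_nth in_set_conv_nth K_def)
    then have c: "ops ?Q f xs \<in> carrier ?Q" "ops ?Q f ys \<in> carrier ?Q"
      using Q xy(1) by (simp_all add: ualgebra_def)
    have "map (\<lambda>e. e i) xs = map (\<lambda>e. e i) ys" if "i \<in> J" for i
      using xy(2) that by (auto simp: list_all2_conv_all_nth K_def intro!: nth_equalityI)
    then have "\<forall>i\<in>J. ops ?Q f xs i = ops ?Q f ys i"
      using J by (simp add: ops_quaternary_clone subset_iff)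
    with c show "(ops ?Q f xs, ops ?Q f ys) \<in> K J" by (simp add: K_def)
  qed (auto simp: K_def)
  define \<alpha> where "\<alpha> = K {(x, y, y, x) |x y. x \<in> ?C \<and> y \<in> ?C}"
  define \<beta> where "\<beta> = K {(x, x, z, z) |x z. x \<in> ?C \<and> z \<in> ?C}"
  define \<gamma> where "\<gamma> = K {(x, y, y, u) |x y u. x \<in> ?C \<and> y \<in> ?C \<and> u \<in> ?C}"
  have C: "\<alpha> \<in> Con ar ?Q" "\<beta> \<in> Con ar ?Q" "\<gamma> \<in> Con ar ?Q"
    unfolding \<alpha>_def \<beta>_def \<gamma>_def by (auto intro!: K)
  have "\<gamma> \<subseteq> \<alpha>" by (auto simp: \<alpha>_def \<gamma>_def K_def)
  then have law: "join ar ?Q \<gamma> (\<beta> \<inter> \<alpha>) = join ar ?Q \<gamma> \<beta> \<inter> \<alpha>"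
    using mod C by (simp add: con_modular_def)
  define p1 where "p1 = restrict (\<lambda>(x, y, z, u). x) ?I"
  define p2 where "p2 = restrict (\<lambda>(x, y, z, u). y) ?I"
  define p3 where "p3 = restrict (\<lambda>(x, y, z, u). z) ?I"
  define p4 where "p4 = restrict (\<lambda>(x, y, z, u). u) ?I"
  have p: "p1 \<in> carrier ?Q" "p2 \<in> carrier ?Q" "p3 \<in> carrier ?Q" "p4 \<in> carrier ?Q"
    unfolding p1_def p2_def p3_def p4_def by (rule quaternary_cloneI[OF alg]; simp)+
  have J: "join ar ?Q \<gamma> \<beta> \<in> Con ar ?Q" by (rule join_in_Con[OF Q C(3,2)])
  have "(p1, p2) \<in> \<beta>" "(p2, p3) \<in> \<gamma>" "(p3, p4) \<in> \<beta>"
    using p by (auto simp: \<beta>_def \<gamma>_def K_def p1_def p2_def p3_def p4_def)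
  then have "(p1, p4) \<in> join ar ?Q \<gamma> \<beta>"
    using join_upper1[of \<gamma> ar ?Q \<beta>] join_upper2[of \<beta> ar ?Q \<gamma>] Con_D(4)[OF J] by blast
  moreover have "(p1, p4) \<in> \<alpha>" using p by (auto simp: \<alpha>_def K_def p1_def p4_def)
  ultimately have "(p1, p4) \<in> join ar ?Q \<gamma> (\<beta> \<inter> \<alpha>)" using law by blast
  then have "(p1, p4) \<in> (\<gamma> \<union> \<beta> \<inter> \<alpha>)\<^sup>*"
    using join_subset_rtrancl[OF Q C(3) Con_Int[OF C(2,1)]] by blast
  moreover have "(p1, m) \<in> \<alpha> \<and> (m (a, b, b, c), a) \<in> \<theta>" if "(p1, m) \<in> (\<gamma> \<union> \<beta> \<inter> \<alpha>)\<^sup>*" for m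
    using that
  proof (induction rule: rtrancl_induct)
    case base
    have "p1 (a, b, b, c) = a" using abc by (simp add: p1_def)
    then show ?case using Con_D(2)[OF C(1) p(1)] Con_D(2)[OF \<theta> abc(1)] by simp
  next
    case (step m m')
    have m': "(p1, m') \<in> \<alpha>" using step \<open>\<gamma> \<subseteq> \<alpha>\<close> Con_D(4)[OF C(1)] by blast
    have undistinguished: "(e (a, a, c, c), e (a, b, b, c)) \<in> \<theta>" if e: "(p1, e) \<in> \<alpha>" for e
    proof -
      have "e \<in> carrier ?Q" using e by (simp add: \<alpha>_def K_def)
      moreover have "e (x, y, y, x) = x" if "x \<in> ?C" "y \<in> ?C" for x y
      proof -
        have "p1 (x, y, y, x) = e (x, y, y, x)" using e that by (auto simp: \<alpha>_def K_def)
        then show ?thesis using that by (simp add: p1_def)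
      qed
      ultimately show ?thesis using no distinguishing[of e] by blast
    qed
    from step(2) have "(m' (a, b, b, c), m (a, b, b, c)) \<in> \<theta>"
    proof
      assume "(m, m') \<in> \<gamma>"
      then have "m (a, b, b, c) = m' (a, b, b, c)" "m' \<in> carrier ?Q"
        using abc by (auto simp: \<gamma>_def K_def)
      then show ?thesis using Con_D(2)[OF \<theta>] abc quaternary_clone_val by metis
    next
      assume "(m, m') \<in> \<beta> \<inter> \<alpha>"
      then have "m (a, a, c, c) = m' (a, a, c, c)" using abc by (auto simp: \<beta>_def K_def)
      then show ?thesis
        using undistinguished[of m] undistinguished[OF m'] step.IH Con_D(3,4)[OF \<theta>] by metis
    qed
    then show ?case using m' step.IH Con_D(4)[OF \<theta>] by blast
  qed
  ultimately have "(p4 (a, b, b, c), a) \<in> \<theta>" by blast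
  then show False using abc ac Con_D(3)[OF \<theta>] by (auto simp: p4_def)
qed

text \<open>In terms of commutator theory, \<open>\<beta>\<close> is abelian over \<open>\<delta>\<close> and centralized by \<open>\<phi>\<close>. Hence a
  function with \<open>m (x, y, y, x) = x\<close> acts like \<open>m (x, u, v, x) = x + r (u - v)\<close> for a scalar \<open>r\<close>, and
  \<open>y = m (x, e, s, x)\<close> does the job if \<open>r\<close> does not annihilate \<open>e - s\<close>. All instances of centrality
  reduce to one remark: two \<open>\<beta>\<close>-related values which are related modulo \<open>\<phi>\<close> (or \<open>\<psi>\<close>) are related
  modulo \<open>\<delta>\<close>.\<close>

lemma translate_pair:
  assumes C: "\<phi> \<in> Con ar A" "\<psi> \<in> Con ar A" "\<beta> \<in> Con ar A"
    and \<delta>: "\<beta> \<inter> \<phi> = \<delta>" "\<beta> \<inter> \<psi> = \<delta>" and J: "\<beta> \<subseteq> join ar A \<phi> \<psi>"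
    and es: "(e, s) \<in> \<beta> - \<delta>" and ex: "(e, x) \<in> \<phi>"
  obtains y where "(x, y) \<in> \<beta> - \<delta>"
proof -
  have \<delta>C: "\<delta> \<in> Con ar A" using Con_Int C \<delta> by metis
  have car: "e \<in> carrier A" "s \<in> carrier A" "x \<in> carrier A"
    using es ex C Con_D(1) by blast+
  note refl = Con_D(2)[OF C(1)] Con_D(2)[OF C(2)] Con_D(2)[OF C(3)]
  obtain m where m: "m \<in> carrier (quaternary_clone ar A)"
    "\<And>x y. x \<in> carrier A \<Longrightarrow> y \<in> carrier A \<Longrightarrow> m (x, y, y, x) = x"
    "(m (e, e, s, s), m (e, e, e, s)) \<notin> \<delta>"
    using day_function[OF \<delta>C car(1,1,2)] es by blast
  note pres = quaternary_clone_preserves[OF m(1)]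
  note val = quaternary_clone_val[OF m(1)]
  \<comment> \<open>The choice of \<open>m\<close> gives this with \<open>s\<close> as the last argument. A chain of \<open>\<phi>\<close>- and \<open>\<psi>\<close>-steps
    from \<open>e\<close> to \<open>s\<close> moves the last argument, and no step changes whether the two values agree modulo \<open>\<delta>\<close>.\<close>
  have ends: "(m (e, e, s, e), m (e, e, e, e)) \<notin> \<delta>"
  proof
    assume start: "(m (e, e, s, e), m (e, e, e, e)) \<in> \<delta>"
    have "(e, s) \<in> (\<phi> \<union> \<psi>)\<^sup>*" using join_subset_rtrancl[OF alg C(1,2)] J es by blast
    moreover have "z \<in> carrier A \<and> (m (e, e, s, z), m (e, e, e, z)) \<in> \<delta>"
      if "(e, z) \<in> (\<phi> \<union> \<psi>)\<^sup>*" for z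
      using that
    proof (induction rule: rtrancl_induct)
      case base
      show ?case using start car by simp
    next
      case (step z z')
      have z: "z \<in> carrier A" "z' \<in> carrier A" using step(2) C Con_D(1) by blast+
      have b: "(m (e, e, s, z'), m (e, e, e, z')) \<in> \<beta>"
        using es z car Con_D(3)[OF C(3)] by (intro pres C refl) blast+
      have *: "(m (e, e, s, z'), m (e, e, e, z')) \<in> \<theta>"
        if t: "\<theta> \<in> Con ar A" "\<delta> \<subseteq> \<theta>" "(z, z') \<in> \<theta>" for \<theta>
      proof -
        have "(m (e, e, s, z'), m (e, e, s, z)) \<in> \<theta>" "(m (e, e, e, z), m (e, e, e, z')) \<in> \<theta>"
          using Con_D(2,3)[OF t(1)] t z car by (auto intro!: pres)
        then show ?thesis using step.IH t(2) Con_D(4)[OF t(1)] by blast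
      qed
      from step(2) have "(m (e, e, s, z'), m (e, e, e, z')) \<in> \<phi> \<union> \<psi>"
        using *[OF C(1)] *[OF C(2)] \<delta> by blast
      then show ?case using b \<delta> z by blast
    qed
    ultimately show False using m(3) by blast
  qed
  have "(m (x, e, e, x), m (x, e, s, x)) \<in> \<beta>" using es car by (intro pres C refl) auto
  then have xy: "(x, m (x, e, s, x)) \<in> \<beta>" using m(2) car by simp
  moreover have "(x, m (x, e, s, x)) \<notin> \<delta>"
  proof
    assume "(x, m (x, e, s, x)) \<in> \<delta>"
    then have "(m (x, e, s, x), m (x, e, e, x)) \<in> \<phi>"
      using \<delta> m(2)[OF car(3,1)] Con_D(3)[OF C(1)] by auto
    moreover have "(m (e, e, s, e), m (x, e, s, x)) \<in> \<phi>" "(m (x, e, e, x), m (e, e, e, e)) \<in> \<phi>"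
      using ex car Con_D(3)[OF C(1)] by (auto intro!: pres C refl)
    ultimately have "(m (e, e, s, e), m (e, e, e, e)) \<in> \<phi>" using Con_D(4)[OF C(1)] by blast
    moreover have "(m (e, e, s, e), m (e, e, e, e)) \<in> \<beta>"
      using es car Con_D(3)[OF C(3)] by (intro pres C refl) blast+
    ultimately show False using ends \<delta> by blast
  qed
  ultimately show ?thesis using that by blast
qed

definition covers :: "('a \<times> 'a) set \<Rightarrow> ('a \<times> 'a) set \<Rightarrow> bool" where
  "covers \<alpha> \<beta> \<longleftrightarrow> \<alpha> \<in> Con ar A \<and> \<beta> \<in> Con ar A \<and> \<alpha> \<subset> \<beta> \<and>
     (\<forall>\<theta>\<in>Con ar A. \<alpha> \<subseteq> \<theta> \<longrightarrow> \<theta> \<subseteq> \<beta> \<longrightarrow> \<theta> = \<alpha> \<or> \<theta> = \<beta>)"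

lemma covers_psubset: "covers \<alpha> \<beta> \<Longrightarrow> \<alpha> \<subset> \<beta>"
  by (simp add: covers_def)

lemma covers_cases:
  "covers \<alpha> \<beta> \<Longrightarrow> \<theta> \<in> Con ar A \<Longrightarrow> \<alpha> \<subseteq> \<theta> \<Longrightarrow> \<theta> \<subseteq> \<beta> \<Longrightarrow> \<theta> = \<alpha> \<or> \<theta> = \<beta>"
  by (simp add: covers_def)

lemma covers_cover: "\<eta> \<in> Cm ar A \<Longrightarrow> covers \<eta> (cover ar A \<eta>)"
  using cover_Con[OF alg] cover_above[OF alg] cover_least[OF alg] Cm_Con
  unfolding covers_def by (metis psubsetI subset_antisym)

lemma transpose_upI:
  "\<beta> \<in> Con ar A \<Longrightarrow> \<gamma> \<in> Con ar A \<Longrightarrow> \<beta> \<inter> \<gamma> = \<alpha> \<Longrightarrow> join ar A \<beta> \<gamma> = \<delta> \<Longrightarrow>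
    ((\<alpha>, \<beta>), (\<gamma>, \<delta>)) \<in> transpose_up ar A"
  unfolding transpose_up_def using Con_Int join_in_Con[OF alg] join_upper2 by blast

lemma transpose_covers_up:
  assumes "((\<alpha>, \<beta>), (\<gamma>, \<delta>)) \<in> transpose_up ar A" "covers \<alpha> \<beta>"
  shows "covers \<gamma> \<delta>"
proof -
  have C: "\<alpha> \<in> Con ar A" "\<beta> \<in> Con ar A" "\<gamma> \<in> Con ar A" "\<delta> \<in> Con ar A"
    and t: "\<beta> \<inter> \<gamma> = \<alpha>" "join ar A \<beta> \<gamma> = \<delta>"
    using assms(1) by (auto simp: transpose_up_def)
  have "\<theta> = \<gamma> \<or> \<theta> = \<delta>" if \<theta>: "\<theta> \<in> Con ar A" "\<gamma> \<subseteq> \<theta>" "\<theta> \<subseteq> \<delta>" for \<theta>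
  proof -
    have "\<beta> \<inter> \<theta> = \<alpha> \<or> \<beta> \<inter> \<theta> = \<beta>"
      by (rule covers_cases[OF assms(2) Con_Int[OF C(2) \<theta>(1)]]) (use t(1) \<theta>(2) in auto)
    moreover have "join ar A \<gamma> (\<beta> \<inter> \<theta>) = \<theta>"
      using modular_law[OF C(3,2) \<theta>(1,2)] t(2) \<theta>(3) by (auto simp: join_commute)
    ultimately show ?thesis using t join_absorb[OF C(3)] by (metis inf_le2 join_commute)
  qed
  moreover have "\<gamma> \<subset> \<delta>"
    using t join_upper1[of \<beta> ar A \<gamma>] join_upper2[of \<gamma> ar A \<beta>] covers_psubset[OF assms(2)] by blast
  ultimately show ?thesis using C by (auto simp: covers_def)
qed

lemma transpose_covers_down:
  assumes "((\<alpha>, \<beta>), (\<gamma>, \<delta>)) \<in> transpose_up ar A" "covers \<gamma> \<delta>"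
  shows "covers \<alpha> \<beta>"
proof -
  have C: "\<alpha> \<in> Con ar A" "\<beta> \<in> Con ar A" "\<gamma> \<in> Con ar A" "\<delta> \<in> Con ar A"
    and t: "\<beta> \<inter> \<gamma> = \<alpha>" "join ar A \<beta> \<gamma> = \<delta>"
    using assms(1) by (auto simp: transpose_up_def)
  have "\<theta> = \<alpha> \<or> \<theta> = \<beta>" if \<theta>: "\<theta> \<in> Con ar A" "\<alpha> \<subseteq> \<theta>" "\<theta> \<subseteq> \<beta>" for \<theta>
  proof -
    have J: "join ar A \<theta> \<gamma> \<in> Con ar A" by (rule join_in_Con[OF alg \<theta>(1) C(3)])
    have "join ar A \<theta> \<gamma> \<subseteq> \<delta>"
      using \<theta>(3) t(2) join_upper1[of \<beta> ar A \<gamma>] join_upper2[of \<gamma> ar A \<beta>] by (intro join_least C) auto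
    then have "join ar A \<theta> \<gamma> = \<gamma> \<or> join ar A \<theta> \<gamma> = \<delta>"
      using covers_cases[OF assms(2) J join_upper2] by blast
    moreover have "join ar A \<theta> \<gamma> \<inter> \<beta> = \<theta>"
      using modular_law[OF \<theta>(1) C(3,2) \<theta>(3)] t(1) join_absorb[OF \<theta>(1,2)] by (simp add: Int_commute)
    ultimately show ?thesis using t join_upper1[of \<beta> ar A \<gamma>] by blast
  qed
  moreover have "\<alpha> \<subset> \<beta>"
  proof -
    have "\<not> \<beta> \<subseteq> \<gamma>"
      using join_absorb[OF C(3), of \<beta>] t(2) covers_psubset[OF assms(2)] join_commute[of ar A \<beta> \<gamma>]
      by auto
    then show ?thesis using t(1) by blast
  qed
  ultimately show ?thesis using C by (auto simp: covers_def)
qed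

end

section \<open>Homomorphic images\<close>

lemma trm_val_hom:
  assumes A: "ualgebra ar A" and v: "range v \<subseteq> carrier A"
    and h: "\<And>f xs. length xs = ar f \<Longrightarrow> set xs \<subseteq> carrier A \<Longrightarrow> h (ops A f xs) = ops B f (map h xs)"
    and s: "wf_trm ar s"
  shows "trm_val A v s \<in> carrier A \<and> trm_val B (h \<circ> v) s = h (trm_val A v s)"
  using s
proof (induction s)
  case (Var n)
  then show ?case using v by auto
next
  case (App f ts)
  let ?xs = "map (trm_val A v) ts"
  have xs: "length ?xs = ar f" "set ?xs \<subseteq> carrier A" using App by auto
  have "map (trm_val B (h \<circ> v)) ts = map h ?xs" using App by (simp add: comp_def)
  then have "trm_val B (h \<circ> v) (App f ts) = h (ops A f ?xs)"
    unfolding trm_val.simps h[OF xs] by (simp only:)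
  moreover have "ops A f ?xs \<in> carrier A" using A xs by (simp only: ualgebra_def)
  ultimately show ?case by (simp add: comp_def)
qed

lemma const_val_carrier:
  assumes A: "ualgebra ar A" and t: "constant_term ar A t"
  shows "const_val A t \<in> carrier A"
proof -
  obtain a where "a \<in> carrier A" using A by (auto simp: ualgebra_def)
  then have v: "range (\<lambda>n :: nat. a) \<subseteq> carrier A" by auto
  have "wf_trm ar t" using t by (simp add: constant_term_def)
  then have "trm_val A (\<lambda>n. a) t \<in> carrier A"
    using trm_val_hom[OF A v, of id A] by simp
  then show ?thesis using const_val_eq[OF t v] by simp
qed

lemma const_val_hom:
  assumes A: "ualgebra ar A" and t: "constant_term ar A t"
    and h: "\<And>f xs. length xs = ar f \<Longrightarrow> set xs \<subseteq> carrier A \<Longrightarrow> h (ops A f xs) = ops B f (map h xs)"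
    and surj: "h ` carrier A = carrier B"
  shows "const_val B t = h (const_val A t)"
  unfolding const_val_def[of B]
proof (rule the_equality)
  have wf: "wf_trm ar t" using t by (simp add: constant_term_def)
  show *: "\<forall>w. range w \<subseteq> carrier B \<longrightarrow> trm_val B w t = h (const_val A t)"
  proof (intro allI impI)
    fix w :: "nat \<Rightarrow> 'c" assume w: "range w \<subseteq> carrier B"
    define v where "v = inv_into (carrier A) h \<circ> w"
    have v: "range v \<subseteq> carrier A"
      using w unfolding v_def surj[symmetric] by (simp add: image_subset_iff inv_into_into)
    have "w = h \<circ> v"
      using w surj by (auto simp: v_def fun_eq_iff f_inv_into_f subset_iff)
    then show "trm_val B w t = h (const_val A t)"
      using trm_val_hom[OF A v h wf] const_val_eq[OF t v] by simp
  qed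
  fix c assume c: "\<forall>w. range w \<subseteq> carrier B \<longrightarrow> trm_val B w t = c"
  obtain a where "a \<in> carrier A" using A by (auto simp: ualgebra_def)
  then have "range (\<lambda>n :: nat. h a) \<subseteq> carrier B" using surj by auto
  then show "c = h (const_val A t)" using c * by metis
qed

definition quotient_algebra :: "('a, 'f) ualg \<Rightarrow> ('a \<times> 'a) set \<Rightarrow> ('a set, 'f) ualg" where
  "quotient_algebra A \<eta> = \<lparr>carrier = carrier A // \<eta>,
     ops = \<lambda>f Xs. \<eta> `` {ops A f (map (\<lambda>X. SOME x. x \<in> X) Xs)}\<rparr>"

lemma quotient_algebra_hom:
  assumes A: "ualgebra ar A" and \<eta>: "\<eta> \<in> Con ar A" and xs: "length xs = ar f" "set xs \<subseteq> carrier A"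
  shows "\<eta> `` {ops A f xs} = ops (quotient_algebra A \<eta>) f (map (\<lambda>x. \<eta> `` {x}) xs)"
proof -
  have eq: "equiv (carrier A) \<eta>" using \<eta> by (simp add: Con_def)
  have "(x, SOME y. y \<in> \<eta> `` {x}) \<in> \<eta>" if "x \<in> set xs" for x
  proof -
    have "x \<in> \<eta> `` {x}" using Con_D(2)[OF \<eta>] that xs(2) by blast
    then have "(SOME y. y \<in> \<eta> `` {x}) \<in> \<eta> `` {x}" by (rule someI)
    then show ?thesis by simp
  qed
  then have "list_all2 (\<lambda>x y. (x, y) \<in> \<eta>) xs (map (\<lambda>X. SOME x. x \<in> X) (map (\<lambda>x. \<eta> `` {x}) xs))"
    by (simp add: list_all2_conv_all_nth)
  then have "(ops A f xs, ops A f (map (\<lambda>X. SOME x. x \<in> X) (map (\<lambda>x. \<eta> `` {x}) xs))) \<in> \<eta>"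
    by (rule Con_D(5)[OF \<eta> xs(1)])
  then show ?thesis unfolding quotient_algebra_def ualg.simps by (rule equiv_class_eq[OF eq])
qed

lemma quotient_hom_image:
  assumes A: "ualgebra ar A" and \<eta>: "\<eta> \<in> Con ar A"
  shows "hom_image ar A (quotient_algebra A \<eta>)"
proof -
  let ?B = "quotient_algebra A \<eta>"
  have car: "carrier ?B = (\<lambda>x. \<eta> `` {x}) ` carrier A"
    by (auto simp: quotient_algebra_def quotient_def)
  have "ops ?B f Xs \<in> carrier ?B" if Xs: "length Xs = ar f" "set Xs \<subseteq> carrier ?B" for f Xs
  proof -
    define xs where "xs = map (inv_into (carrier A) (\<lambda>x. \<eta> `` {x})) Xs"
    have xs: "Xs = map (\<lambda>x. \<eta> `` {x}) xs" "set xs \<subseteq> carrier A"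
    proof -
      have *: "\<eta> `` {inv_into (carrier A) (\<lambda>x. \<eta> `` {x}) X} = X" if "X \<in> set Xs" for X
        using f_inv_into_f[of X "\<lambda>x. \<eta> `` {x}" "carrier A"] that Xs(2) car by blast
      show "Xs = map (\<lambda>x. \<eta> `` {x}) xs"
        unfolding xs_def map_map comp_def by (rule map_idI[symmetric]) (rule *)
      show "set xs \<subseteq> carrier A"
        using Xs(2) unfolding xs_def car by (auto simp: subset_iff intro: inv_into_into)
    qed
    have len: "length xs = ar f" using Xs(1) xs(1) by simp
    have "ops ?B f Xs = \<eta> `` {ops A f xs}"
      unfolding xs(1) quotient_algebra_hom[OF A \<eta> len xs(2)] ..
    moreover have "ops A f xs \<in> carrier A" using A len xs(2) by (simp add: ualgebra_def)
    ultimately show ?thesis using car by simp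
  qed
  moreover have "carrier ?B \<noteq> {}" using A car by (simp add: ualgebra_def)
  ultimately have "ualgebra ar ?B" by (simp add: ualgebra_def)
  then show ?thesis
    unfolding hom_image_def using car quotient_algebra_hom[OF A \<eta>]
    by (intro conjI exI[of _ "\<lambda>x. \<eta> `` {x}"]) auto
qed

lemma Con_preimage:
  assumes A: "ualgebra ar A"
    and h: "\<And>f xs. length xs = ar f \<Longrightarrow> set xs \<subseteq> carrier A \<Longrightarrow> h (ops A f xs) = ops B f (map h xs)"
    and surj: "h ` carrier A = carrier B" and \<psi>: "\<psi> \<in> Con ar B"
  shows "{(x, y). x \<in> carrier A \<and> y \<in> carrier A \<and> (h x, h y) \<in> \<psi>} \<in> Con ar A"
proof (rule Con_I, goal_cases)
  case (2 x) then show ?case using Con_D(2)[OF \<psi>] surj by auto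
next
  case (3 x y) then show ?case using Con_D(3)[OF \<psi>, of "h x" "h y"] by simp
next
  case (4 x y z) then show ?case using Con_D(4)[OF \<psi>, of "h x" "h y" "h z"] by simp
next
  case (5 f xs ys)
  then have s: "set xs \<subseteq> carrier A" "set ys \<subseteq> carrier A" "length ys = ar f"
    by (auto simp: list_all2_conv_all_nth in_set_conv_nth)
  have "list_all2 (\<lambda>x y. (x, y) \<in> \<psi>) (map h xs) (map h ys)"
    using 5(2) by (auto simp: list_all2_conv_all_nth)
  then have "(ops B f (map h xs), ops B f (map h ys)) \<in> \<psi>"
    using Con_D(5)[OF \<psi>, of "map h xs" f] 5(1) by simp
  then show ?case using s 5(1) A by (simp add: h ualgebra_def)
qed auto

section \<open>Covers in strongly Fregean algebras\<close>

locale strongly_Fregean_algebra =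
  fixes ar :: "'f \<Rightarrow> nat" and t :: "'f trm" and A :: "('a, 'f) ualg"
  assumes alg: "ualgebra ar A" and const: "constant_term ar A t"
    and strongly_Fregean: "strongly_Fregean ar t A"

sublocale strongly_Fregean_algebra \<subseteq> modular_algebra ar A
  by unfold_locales (use alg strongly_Fregean in \<open>simp_all add: strongly_Fregean_def\<close>)

context strongly_Fregean_algebra
begin

abbreviation unit :: 'a where "unit \<equiv> const_val A t"

lemma unit_carrier: "unit \<in> carrier A"
  by (rule const_val_carrier[OF alg const])

lemma unit_class_subset:
  assumes C: "\<alpha> \<in> Con ar A" "\<beta> \<in> Con ar A" and sub: "\<And>x. (unit, x) \<in> \<alpha> \<Longrightarrow> (unit, x) \<in> \<beta>"
  shows "\<alpha> \<subseteq> \<beta>"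
proof -
  have "hom_image ar A A"
    unfolding hom_image_def using alg by (intro conjI exI[of _ id]) auto
  then have "Fregean ar t A"
    by (rule strongly_Fregean_hom_image[OF alg const strongly_Fregean])
  then have "one_regular ar t A" by (simp add: Fregean_def)
  moreover have "(\<alpha> \<inter> \<beta>) `` {unit} = \<alpha> `` {unit}" using sub by auto
  ultimately have "\<alpha> \<inter> \<beta> = \<alpha>"
    unfolding one_regular_def using C(1) Con_Int[OF C] by blast
  then show ?thesis by blast
qed

lemma unit_class_witness:
  assumes "\<alpha> \<in> Con ar A" "\<beta> \<in> Con ar A" "\<not> \<alpha> \<subseteq> \<beta>"
  obtains x where "(unit, x) \<in> \<alpha>" "(unit, x) \<notin> \<beta>"
  using unit_class_subset[OF assms(1,2)] assms(3) by blast

text \<open>This is congruence orderability of the quotient by \<open>\<eta>\<close>, expressed in \<open>A\<close>.\<close>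

lemma orderable_above:
  assumes \<eta>: "\<eta> \<in> Con ar A" and xy: "x \<in> carrier A" "y \<in> carrier A"
    and same: "\<And>\<theta>. \<theta> \<in> Con ar A \<Longrightarrow> \<eta> \<subseteq> \<theta> \<Longrightarrow> (unit, x) \<in> \<theta> \<longleftrightarrow> (unit, y) \<in> \<theta>"
  shows "(x, y) \<in> \<eta>"
proof -
  let ?B = "quotient_algebra A \<eta>"
  define h where "h x = \<eta> `` {x}" for x
  have hom: "\<And>f xs. length xs = ar f \<Longrightarrow> set xs \<subseteq> carrier A \<Longrightarrow> h (ops A f xs) = ops ?B f (map h xs)"
    using quotient_algebra_hom[OF alg \<eta>] unfolding h_def by blast
  have surj: "h ` carrier A = carrier ?B"
    by (auto simp: quotient_algebra_def quotient_def h_def)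
  have eq: "equiv (carrier A) \<eta>" using \<eta> by (simp add: Con_def)
  have unit: "const_val ?B t = h unit" by (rule const_val_hom[OF alg const hom surj])
  have "Fregean ar t ?B"
    using strongly_Fregean quotient_hom_image[OF alg \<eta>] by (simp add: strongly_Fregean_def)
  then have ord: "Cg ar ?B {(h unit, h x)} = Cg ar ?B {(h unit, h y)} \<Longrightarrow> h x = h y"
    using xy surj unfolding Fregean_def congruence_orderable_def unit by blast
  have "(h unit, h x) \<in> \<psi> \<longleftrightarrow> (h unit, h y) \<in> \<psi>" if \<psi>: "\<psi> \<in> Con ar ?B" for \<psi>
  proof -
    let ?\<theta> = "{(x, y). x \<in> carrier A \<and> y \<in> carrier A \<and> (h x, h y) \<in> \<psi>}"
    have "?\<theta> \<in> Con ar A" by (rule Con_preimage[OF alg hom surj \<psi>])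
    moreover have "\<eta> \<subseteq> ?\<theta>"
    proof clarify
      fix u v assume uv: "(u, v) \<in> \<eta>"
      then have "u \<in> carrier A" "v \<in> carrier A" using Con_D(1)[OF \<eta>] by blast+
      moreover have "h u = h v" unfolding h_def by (rule equiv_class_eq[OF eq uv])
      moreover have "(h v, h v) \<in> \<psi>" using Con_D(2)[OF \<psi>] surj \<open>v \<in> carrier A\<close> by blast
      ultimately show "u \<in> carrier A \<and> v \<in> carrier A \<and> (h u, h v) \<in> \<psi>" by simp
    qed
    ultimately show ?thesis using same[of ?\<theta>] xy unit_carrier by simp
  qed
  then have "{\<psi> \<in> Con ar ?B. {(h unit, h x)} \<subseteq> \<psi>} = {\<psi> \<in> Con ar ?B. {(h unit, h y)} \<subseteq> \<psi>}" by auto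
  then have "h x = h y" by (intro ord) (simp only: Cg_def)
  then show ?thesis unfolding h_def using eq_equiv_class[OF _ eq xy(2)] by blast
qed

text \<open>If \<open>x\<close> is outside the unit class of \<open>\<eta>\<^sup>+\<close>, then so is \<open>y\<close>, and no pair \<open>(1, x)\<close>, \<open>(1, y)\<close> is
  in \<open>\<eta>\<close>. So a congruence above \<open>\<eta>\<close> with one of these pairs contains \<open>\<eta>\<^sup>+ \<ni> (x, y)\<close>, and hence the
  other pair; now orderability gives \<open>(x, y) \<in> \<eta>\<close>.\<close>

lemma cover_pairs_in_unit_class:
  assumes \<eta>: "\<eta> \<in> Cm ar A" and xy: "(x, y) \<in> cover ar A \<eta>" "(x, y) \<notin> \<eta>"
  shows "(unit, x) \<in> cover ar A \<eta>"
proof (rule ccontr)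
  assume x: "(unit, x) \<notin> cover ar A \<eta>"
  let ?\<alpha> = "cover ar A \<eta>"
  have C: "\<eta> \<in> Con ar A" "?\<alpha> \<in> Con ar A" "\<eta> \<subset> ?\<alpha>"
    using Cm_Con[OF \<eta>] cover_Con[OF alg \<eta>] cover_above[OF alg \<eta>] by auto
  have y: "(unit, y) \<notin> ?\<alpha>" using x xy(1) Con_D(3,4)[OF C(2)] by metis
  have "(x, y) \<in> \<eta>"
  proof (rule orderable_above[OF C(1)])
    show "x \<in> carrier A" "y \<in> carrier A" using xy(1) Con_D(1)[OF C(2)] by auto
    fix \<theta> assume \<theta>: "\<theta> \<in> Con ar A" "\<eta> \<subseteq> \<theta>"
    show "(unit, x) \<in> \<theta> \<longleftrightarrow> (unit, y) \<in> \<theta>"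
    proof (cases "\<theta> = \<eta>")
      case True
      then show ?thesis using x y C(3) by blast
    next
      case False
      then have "(x, y) \<in> \<theta>" using cover_least[OF alg \<eta> \<theta>(1)] \<theta>(2) xy(1) by blast
      then show ?thesis using Con_D(3,4)[OF \<theta>(1)] by metis
    qed
  qed
  then show False using xy(2) by simp
qed

text \<open>Both pairs are in \<open>\<eta>\<^sup>+\<close> and not in \<open>\<eta>\<close>, so each of them is in all congruences strictly above
  \<open>\<eta>\<close>, and orderability does not tell them apart.\<close>

lemma cover_unit_class_splits_in_two:
  assumes \<eta>: "\<eta> \<in> Cm ar A"
    and xy: "(unit, x) \<in> cover ar A \<eta>" "(unit, x) \<notin> \<eta>" "(unit, y) \<in> cover ar A \<eta>" "(unit, y) \<notin> \<eta>"
  shows "(x, y) \<in> \<eta>"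
proof (rule orderable_above[OF Cm_Con[OF \<eta>]])
  show "x \<in> carrier A" "y \<in> carrier A" using xy(1,3) Con_D(1)[OF cover_Con[OF alg \<eta>]] by auto
  fix \<theta> assume \<theta>: "\<theta> \<in> Con ar A" "\<eta> \<subseteq> \<theta>"
  show "(unit, x) \<in> \<theta> \<longleftrightarrow> (unit, y) \<in> \<theta>"
    using cover_least[OF alg \<eta> \<theta>(1)] \<theta>(2) xy by (cases "\<theta> = \<eta>") auto
qed

lemma in_iff_same_side:
  assumes \<eta>: "\<eta> \<in> Cm ar A" and xy: "(unit, x) \<in> cover ar A \<eta>" "(unit, y) \<in> cover ar A \<eta>"
  shows "(x, y) \<in> \<eta> \<longleftrightarrow> ((unit, x) \<in> \<eta> \<longleftrightarrow> (unit, y) \<in> \<eta>)"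
  using cover_unit_class_splits_in_two[OF \<eta> xy(1) _ xy(2)] Con_D(3,4)[OF Cm_Con[OF \<eta>]] by metis

lemma cover_pairs_match:
  assumes \<eta>: "\<eta> \<in> Cm ar A"
    and p: "(u, v) \<in> cover ar A \<eta> - \<eta>" and q: "(u', v') \<in> cover ar A \<eta> - \<eta>"
  shows "(u, u') \<in> \<eta> \<and> (v, v') \<in> \<eta> \<or> (u, v') \<in> \<eta> \<and> (v, u') \<in> \<eta>"
proof -
  have *: "(unit, x) \<in> cover ar A \<eta> \<and> (unit, y) \<in> cover ar A \<eta>"
    if "(x, y) \<in> cover ar A \<eta> - \<eta>" for x y
  proof -
    have "(unit, x) \<in> cover ar A \<eta>" using cover_pairs_in_unit_class[OF \<eta>, of x y] that by blast
    then show ?thesis using Con_D(4)[OF cover_Con[OF alg \<eta>], of unit x y] that by blast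
  qed
  note iff = in_iff_same_side[OF \<eta>]
  note uv = *[OF p, THEN conjunct1] *[OF p, THEN conjunct2]
  note uv' = *[OF q, THEN conjunct1] *[OF q, THEN conjunct2]
  have "(u, v) \<notin> \<eta>" "(u', v') \<notin> \<eta>" using p q by auto
  then show ?thesis
    unfolding iff[OF uv] iff[OF uv'] iff[OF uv(1) uv'(1)] iff[OF uv(2) uv'(2)]
      iff[OF uv(1) uv'(2)] iff[OF uv(2) uv'(1)] by blast
qed

section \<open>Projective covers\<close>

text \<open>Both \<open>\<phi>\<close> and \<open>\<psi>\<close> cut the common unit class of their covers in two. They are alike if every
  unary congruence-preserving function acts on the two parts in the same way: it glues those of
  \<open>\<phi>\<close> iff it glues those of \<open>\<psi>\<close>. For \<open>\<phi> \<noteq> \<psi>\<close> this is the form which module isomorphism of the covers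
  takes when each of them has two elements. Unlike the existence of a common lower interval, it is
  visibly transitive.\<close>

definition alike :: "('a \<times> 'a) set \<Rightarrow> ('a \<times> 'a) set \<Rightarrow> bool" where
  "alike \<phi> \<psi> \<longleftrightarrow> \<phi> \<in> Cm ar A \<and> \<psi> \<in> Cm ar A \<and> cover ar A \<phi> = cover ar A \<psi> \<and>
     (\<forall>p u v u' v'. congruence_preserving ar A p \<longrightarrow>
        (u, v) \<in> cover ar A \<phi> - \<phi> \<longrightarrow> (u', v') \<in> cover ar A \<psi> - \<psi> \<longrightarrow>
        ((p u, p v) \<in> \<phi> \<longleftrightarrow> (p u', p v') \<in> \<psi>))"

lemma alikeD:
  assumes "alike \<phi> \<psi>"
  shows "\<phi> \<in> Cm ar A" "\<psi> \<in> Cm ar A" "cover ar A \<phi> = cover ar A \<psi>"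
    and "\<And>p u v u' v'. congruence_preserving ar A p \<Longrightarrow> (u, v) \<in> cover ar A \<phi> - \<phi> \<Longrightarrow>
      (u', v') \<in> cover ar A \<psi> - \<psi> \<Longrightarrow> (p u, p v) \<in> \<phi> \<longleftrightarrow> (p u', p v') \<in> \<psi>"
  using assms unfolding alike_def by blast+

lemma alike_refl:
  assumes \<phi>: "\<phi> \<in> Cm ar A" shows "alike \<phi> \<phi>"
proof -
  have "(p u, p v) \<in> \<phi> \<longleftrightarrow> (p u', p v') \<in> \<phi>"
    if p: "congruence_preserving ar A p"
      and uv: "(u, v) \<in> cover ar A \<phi> - \<phi>" "(u', v') \<in> cover ar A \<phi> - \<phi>" for p u v u' v'
  proof -
    note c = congruence_preservingD[OF p Cm_Con[OF \<phi>]]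
    note eq = Con_D(3,4)[OF Cm_Con[OF \<phi>]]
    from cover_pairs_match[OF \<phi> uv] show ?thesis
    proof
      assume "(u, u') \<in> \<phi> \<and> (v, v') \<in> \<phi>"
      then have "(p u, p u') \<in> \<phi>" "(p v, p v') \<in> \<phi>" using c by blast+
      then show ?thesis using eq by metis
    next
      assume "(u, v') \<in> \<phi> \<and> (v, u') \<in> \<phi>"
      then have "(p u, p v') \<in> \<phi>" "(p v, p u') \<in> \<phi>" using c by blast+
      then show ?thesis using eq by metis
    qed
  qed
  then show ?thesis using \<phi> unfolding alike_def by blast
qed

lemma alike_sym: "alike \<phi> \<psi> \<Longrightarrow> alike \<psi> \<phi>"
  unfolding alike_def by metis

lemma alike_trans:
  assumes "alike \<phi> \<psi>" "alike \<psi> \<chi>" shows "alike \<phi> \<chi>"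
proof -
  obtain r s where "(r, s) \<in> cover ar A \<psi> - \<psi>"
    using cover_above[OF alg alikeD(2)[OF assms(1)]] by auto
  then have "(p u, p v) \<in> \<phi> \<longleftrightarrow> (p u', p v') \<in> \<chi>"
    if "congruence_preserving ar A p" "(u, v) \<in> cover ar A \<phi> - \<phi>" "(u', v') \<in> cover ar A \<chi> - \<chi>"
    for p u v u' v'
    using alikeD(4)[OF assms(1) that(1,2)] alikeD(4)[OF assms(2) that(1) _ that(3)] by metis
  then show ?thesis using alikeD(1-3)[OF assms(1)] alikeD(1-3)[OF assms(2)] unfolding alike_def by simp
qed

lemma cover_eq_covers:
  assumes \<phi>: "\<phi> \<in> Cm ar A" and c: "covers \<phi> \<chi>" shows "cover ar A \<phi> = \<chi>"
proof -
  have "cover ar A \<phi> \<subseteq> \<chi>" using cover_least[OF alg \<phi>] c by (simp add: covers_def)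
  then show ?thesis
    using covers_cases[OF c cover_Con[OF alg \<phi>]] cover_above[OF alg \<phi>] by blast
qed

lemma cover_subset_join:
  assumes "\<phi> \<in> Cm ar A" "\<theta> \<in> Con ar A" "\<not> \<theta> \<subseteq> \<phi>"
  shows "cover ar A \<phi> \<subseteq> join ar A \<theta> \<phi>"
proof (rule cover_least[OF alg assms(1)])
  show "join ar A \<theta> \<phi> \<in> Con ar A" by (rule join_in_Con[OF alg assms(2) Cm_Con[OF assms(1)]])
  show "\<phi> \<subset> join ar A \<theta> \<phi>" using join_upper1[of \<theta> ar A \<phi>] join_upper2[of \<phi> ar A \<theta>] assms(3) by blast
qed

lemma cover_eq_join:
  assumes "\<phi> \<in> Cm ar A" "covers \<delta> \<beta>" "\<beta> \<inter> \<phi> = \<delta>"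
  shows "cover ar A \<phi> = join ar A \<beta> \<phi>" "((\<delta>, \<beta>), (\<phi>, cover ar A \<phi>)) \<in> transpose_up ar A"
proof -
  have "\<beta> \<in> Con ar A" using assms(2) by (simp add: covers_def)
  then have t: "((\<delta>, \<beta>), (\<phi>, join ar A \<beta> \<phi>)) \<in> transpose_up ar A"
    using assms Cm_Con by (intro transpose_upI) auto
  show "cover ar A \<phi> = join ar A \<beta> \<phi>"
    using cover_eq_covers[OF assms(1) transpose_covers_up[OF t assms(2)]] .
  then show "((\<delta>, \<beta>), (\<phi>, cover ar A \<phi>)) \<in> transpose_up ar A" using t by simp
qed

text \<open>By translation along \<open>\<phi>\<close>, each \<open>x\<close> in the unit class of \<open>\<phi>\<close> starts a pair of \<open>\<beta> - \<delta>\<close>, hence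
  a pair of \<open>\<psi>\<^sup>+ - \<psi>\<close>; but such pairs live in the unit class of \<open>\<psi>\<^sup>+\<close>.\<close>

lemma cover_subset_of_common_lower:
  assumes Cm: "\<phi> \<in> Cm ar A" "\<psi> \<in> Cm ar A" and ne: "\<phi> \<noteq> \<psi>"
    and c: "covers \<delta> \<beta>" and \<delta>: "\<beta> \<inter> \<phi> = \<delta>" "\<beta> \<inter> \<psi> = \<delta>"
  shows "cover ar A \<phi> \<subseteq> cover ar A \<psi>"
proof -
  have C: "\<delta> \<in> Con ar A" "\<beta> \<in> Con ar A" "\<delta> \<subset> \<beta>" using c by (auto simp: covers_def)
  note Cn = Cm_Con[OF Cm(1)] Cm_Con[OF Cm(2)]
  have up: "cover ar A \<phi> = join ar A \<beta> \<phi>" "cover ar A \<psi> = join ar A \<beta> \<psi>"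
    using cover_eq_join(1) Cm c \<delta> by blast+
  have b: "\<beta> \<subseteq> cover ar A \<psi>" "\<beta> \<subseteq> cover ar A \<phi>" unfolding up by (rule join_upper1)+
  have "\<not> \<phi> \<subseteq> \<psi>"
  proof
    assume "\<phi> \<subseteq> \<psi>"
    then have "cover ar A \<phi> \<subseteq> \<psi>" using ne cover_least[OF alg Cm(1) Cn(2)] by blast
    then show False using b(2) \<delta>(2) C(3) by blast
  qed
  then have J: "\<beta> \<subseteq> join ar A \<phi> \<psi>" using cover_subset_join[OF Cm(2) Cn(1)] b(1) by blast
  obtain s where s: "(unit, s) \<in> \<beta> - \<delta>" using unit_class_witness[OF C(2,1)] C(3) by blast
  have "\<phi> \<subseteq> cover ar A \<psi>"
  proof (rule unit_class_subset[OF Cn(1) cover_Con[OF alg Cm(2)]])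
    fix x assume "(unit, x) \<in> \<phi>"
    from translate_pair[OF Cn C(2) \<delta> J s this]
    obtain y where "(x, y) \<in> \<beta> - \<delta>" .
    then show "(unit, x) \<in> cover ar A \<psi>"
      using cover_pairs_in_unit_class[OF Cm(2), of x y] b(1) \<delta>(2) by blast
  qed
  then show ?thesis unfolding up(1) using b(1) by (intro join_least cover_Con[OF alg Cm(2)])
qed

lemma alike_of_common_lower:
  assumes Cm: "\<phi> \<in> Cm ar A" "\<psi> \<in> Cm ar A"
    and c: "covers \<delta> \<beta>" and \<delta>: "\<beta> \<inter> \<phi> = \<delta>" "\<beta> \<inter> \<psi> = \<delta>"
  shows "alike \<phi> \<psi>"
proof (cases "\<phi> = \<psi>")
  case True
  then show ?thesis using alike_refl Cm by simp
next
  case False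
  have eq: "cover ar A \<phi> = cover ar A \<psi>"
    using cover_subset_of_common_lower[OF Cm False c \<delta>]
      cover_subset_of_common_lower[OF Cm(2,1) not_sym[OF False] c \<delta>(2,1)] by blast
  have C: "\<beta> \<in> Con ar A" "\<delta> \<subset> \<beta>" using c by (auto simp: covers_def)
  obtain r s where rs: "(r, s) \<in> \<beta>" "(r, s) \<notin> \<delta>" using C(2) by auto
  have "\<beta> \<subseteq> cover ar A \<phi>" using cover_eq_join(1)[OF Cm(1) c \<delta>(1)] join_upper1 by metis
  then have rs': "(r, s) \<in> cover ar A \<phi> - \<phi>" "(r, s) \<in> cover ar A \<psi> - \<psi>" using rs \<delta> eq by auto
  have "(p u, p v) \<in> \<phi> \<longleftrightarrow> (p u', p v') \<in> \<psi>"
    if p: "congruence_preserving ar A p" "(u, v) \<in> cover ar A \<phi> - \<phi>" "(u', v') \<in> cover ar A \<psi> - \<psi>"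
    for p u v u' v'
  proof -
    have "(p r, p s) \<in> \<beta>" by (rule congruence_preservingD[OF p(1) C(1) rs(1)])
    then have "(p r, p s) \<in> \<phi> \<longleftrightarrow> (p r, p s) \<in> \<psi>" using \<delta> by blast
    then show ?thesis
      using alikeD(4)[OF alike_refl[OF Cm(1)] p(1,2) rs'(1)]
        alikeD(4)[OF alike_refl[OF Cm(2)] p(1) rs'(2) p(3)] by simp
  qed
  then show ?thesis using Cm eq unfolding alike_def by blast
qed

text \<open>Every interval projective to \<open>I[\<phi>, \<phi>\<^sup>+]\<close> is a cover, and all the completely meet irreducible
  congruences to which it transposes up are alike \<open>\<phi>\<close>. Only a downward step needs an argument:
  some such congruence lies above the upper interval, hence above both, and any two above the
  lower one are alike.\<close>

lemma projective_imp_alike: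
  assumes \<phi>: "\<phi> \<in> Cm ar A" and pr: "((\<phi>, cover ar A \<phi>), (\<gamma>, \<delta>)) \<in> projective ar A"
  shows "covers \<gamma> \<delta> \<and> (\<forall>\<eta>\<in>Cm ar A. \<gamma> \<subseteq> \<eta> \<longrightarrow> \<not> \<delta> \<subseteq> \<eta> \<longrightarrow> alike \<phi> \<eta>)"
  using pr unfolding projective_def
proof (induction rule: rtrancl_induct2)
  case refl
  have "alike \<phi> \<eta>" if "\<eta> \<in> Cm ar A" "\<phi> \<subseteq> \<eta>" "\<not> cover ar A \<phi> \<subseteq> \<eta>" for \<eta>
  proof -
    have "\<phi> = \<eta>" using cover_least[OF alg \<phi> Cm_Con[OF that(1)]] that(2,3) by blast
    then show ?thesis using alike_refl[OF \<phi>] by simp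
  qed
  then show ?case using covers_cover[OF \<phi>] by blast
next
  case (step \<gamma> \<delta> \<gamma>' \<delta>')
  have c: "covers \<gamma> \<delta>" and al: "\<And>\<eta>. \<eta> \<in> Cm ar A \<Longrightarrow> \<gamma> \<subseteq> \<eta> \<Longrightarrow> \<not> \<delta> \<subseteq> \<eta> \<Longrightarrow> alike \<phi> \<eta>"
    using step.IH by blast+
  from step(2) consider (up) "((\<gamma>, \<delta>), (\<gamma>', \<delta>')) \<in> transpose_up ar A"
    | (down) "((\<gamma>', \<delta>'), (\<gamma>, \<delta>)) \<in> transpose_up ar A" by blast
  then show ?case
  proof cases
    case up
    then have t: "\<delta> \<inter> \<gamma>' = \<gamma>" "join ar A \<delta> \<gamma>' = \<delta>'" by (auto simp: transpose_up_def)
    have "alike \<phi> \<eta>" if \<eta>: "\<eta> \<in> Cm ar A" "\<gamma>' \<subseteq> \<eta>" "\<not> \<delta>' \<subseteq> \<eta>" for \<eta>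
    proof (rule al[OF \<eta>(1)])
      show "\<gamma> \<subseteq> \<eta>" using t \<eta> by blast
      show "\<not> \<delta> \<subseteq> \<eta>" using join_least[OF Cm_Con[OF \<eta>(1)] _ \<eta>(2), of \<delta>] t(2) \<eta>(3) by blast
    qed
    then show ?thesis using transpose_covers_up[OF up c] by blast
  next
    case down
    then have t: "\<delta>' \<inter> \<gamma> = \<gamma>'" "join ar A \<delta>' \<gamma> = \<delta>" and C: "\<delta>' \<in> Con ar A" "\<gamma> \<in> Con ar A" "\<delta> \<in> Con ar A"
      by (auto simp: transpose_up_def)
    have c': "covers \<gamma>' \<delta>'" by (rule transpose_covers_down[OF down c])
    have meet: "\<delta>' \<inter> \<eta> = \<gamma>'" if \<eta>: "\<eta> \<in> Cm ar A" "\<gamma>' \<subseteq> \<eta>" "\<not> \<delta>' \<subseteq> \<eta>" for \<eta>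
      using covers_cases[OF c' Con_Int[OF C(1) Cm_Con[OF \<eta>(1)]]] \<eta>(2,3) t(1) by blast
    obtain u v where uv: "(u, v) \<in> \<delta>" "(u, v) \<notin> \<gamma>" using covers_psubset[OF c] by auto
    then have "u \<in> carrier A" "v \<in> carrier A" using Con_D(1)[OF C(3)] by auto
    from Cm_separates[OF alg C(2) uv(2) this]
    obtain \<mu> where \<mu>: "\<mu> \<in> Cm ar A" "\<gamma> \<subseteq> \<mu>" "(u, v) \<notin> \<mu>" .
    then have "\<not> \<delta> \<subseteq> \<mu>" using uv by blast
    then have \<mu>': "\<gamma>' \<subseteq> \<mu>" "\<not> \<delta>' \<subseteq> \<mu>"
      using t \<mu>(2) join_least[OF Cm_Con[OF \<mu>(1)] _ \<mu>(2), of \<delta>'] by blast+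
    have "alike \<phi> \<mu>" using al[OF \<mu>(1,2)] \<open>\<not> \<delta> \<subseteq> \<mu>\<close> by blast
    then have "alike \<phi> \<eta>" if \<eta>: "\<eta> \<in> Cm ar A" "\<gamma>' \<subseteq> \<eta>" "\<not> \<delta>' \<subseteq> \<eta>" for \<eta>
      using alike_of_common_lower[OF \<mu>(1) \<eta>(1) c' meet[OF \<mu>(1) \<mu>'] meet[OF \<eta>]] alike_trans by blast
    then show ?thesis using c' by blast
  qed
qed

lemma Cm_sim_imp_alike:
  assumes "(\<phi>, \<psi>) \<in> Cm_sim ar A" shows "alike \<phi> \<psi>"
proof -
  have *: "\<phi> \<in> Cm ar A" "\<psi> \<in> Cm ar A" "((\<phi>, cover ar A \<phi>), (\<psi>, cover ar A \<psi>)) \<in> projective ar A"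
    using assms by (auto simp: Cm_sim_def)
  then have "\<forall>\<eta>\<in>Cm ar A. \<psi> \<subseteq> \<eta> \<longrightarrow> \<not> cover ar A \<psi> \<subseteq> \<eta> \<longrightarrow> alike \<phi> \<eta>"
    using projective_imp_alike[OF *(1,3)] by (rule_tac conjunct2)
  then show ?thesis using *(2) cover_above[OF alg *(2)] by blast
qed

section \<open>The operation on a class of projective congruences\<close>

lemma mem_bullet:
  assumes "\<eta> \<in> Cm ar A"
  shows "(u, v) \<in> bullet ar A \<eta> \<phi> \<psi> \<longleftrightarrow>
    (u, v) \<in> cover ar A \<eta> \<and> ((u, v) \<in> \<phi> \<longleftrightarrow> (u, v) \<in> \<psi>)"
  using Con_D(1)[OF cover_Con[OF alg assms]] unfolding bullet_def by blast

lemma bullet_self: "\<eta> \<in> Cm ar A \<Longrightarrow> bullet ar A \<eta> \<phi> \<phi> = cover ar A \<eta>"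
  by (auto simp: mem_bullet)

lemma bullet_commute: "bullet ar A \<eta> \<phi> \<psi> = bullet ar A \<eta> \<psi> \<phi>"
  unfolding bullet_def by blast

lemma bullet_cover:
  "\<eta> \<in> Cm ar A \<Longrightarrow> \<phi> \<subseteq> cover ar A \<eta> \<Longrightarrow> bullet ar A \<eta> (cover ar A \<eta>) \<phi> = \<phi>"
  by (auto simp: mem_bullet)

lemma bullet_cancel:
  "\<eta> \<in> Cm ar A \<Longrightarrow> \<psi> \<subseteq> cover ar A \<eta> \<Longrightarrow> bullet ar A \<eta> (bullet ar A \<eta> \<phi> \<psi>) \<phi> = \<psi>"
  by (auto simp: mem_bullet)

lemma bullet_eq_cover:
  "\<eta> \<in> Cm ar A \<Longrightarrow> \<phi> \<subseteq> cover ar A \<eta> \<Longrightarrow> \<psi> \<subseteq> cover ar A \<eta> \<Longrightarrow>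
    bullet ar A \<eta> \<phi> \<psi> = cover ar A \<eta> \<Longrightarrow> \<phi> = \<psi>"
  by (auto simp: mem_bullet set_eq_iff)

lemma bullet_cong: "cover ar A \<eta> = cover ar A \<eta>' \<Longrightarrow> bullet ar A \<eta> = bullet ar A \<eta>'"
  by (simp add: bullet_def fun_eq_iff)

lemma not_subset_if_alike:
  assumes al: "alike \<phi> \<psi>" and ne: "\<phi> \<noteq> \<psi>" shows "\<not> \<phi> \<subseteq> \<psi>"
proof
  assume "\<phi> \<subseteq> \<psi>"
  then have "cover ar A \<phi> \<subseteq> \<psi>"
    using ne cover_least[OF alg alikeD(1)[OF al] Cm_Con[OF alikeD(2)[OF al]]] by blast
  then show False using cover_above[OF alg alikeD(2)[OF al]] alikeD(3)[OF al] by blast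
qed

lemma transpose_distinct_alike:
  assumes al: "alike \<phi> \<psi>" and ne: "\<phi> \<noteq> \<psi>"
  shows "((\<phi> \<inter> \<psi>, \<psi>), (\<phi>, cover ar A \<phi>)) \<in> transpose_up ar A"
proof (rule transpose_upI)
  note Cm = alikeD(1)[OF al] alikeD(2)[OF al]
  show "\<psi> \<in> Con ar A" "\<phi> \<in> Con ar A" using Cm Cm_Con by auto
  show "\<psi> \<inter> \<phi> = \<phi> \<inter> \<psi>" by blast
  have "\<not> \<psi> \<subseteq> \<phi>" using not_subset_if_alike[OF alike_sym[OF al]] ne by blast
  then have "cover ar A \<phi> \<subseteq> join ar A \<psi> \<phi>" by (rule cover_subset_join[OF Cm(1) Cm_Con[OF Cm(2)]])
  moreover have "join ar A \<psi> \<phi> \<subseteq> cover ar A \<phi>"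
    using cover_above[OF alg Cm(1)] cover_above[OF alg Cm(2)] alikeD(3)[OF al]
    by (intro join_least cover_Con[OF alg Cm(1)]) auto
  ultimately show "join ar A \<psi> \<phi> = cover ar A \<phi>" by blast
qed

text \<open>Transitivity holds since each unit class is split in two, so that agreement of \<open>\<phi>\<close> and
  \<open>\<psi>\<close> on a pair is a parity condition; compatibility with the operations is what alikeness says.\<close>

lemma bullet_in_Con:
  assumes al: "alike \<phi> \<psi>" shows "bullet ar A \<phi> \<phi> \<psi> \<in> Con ar A" (is "?\<beta> \<in> _")
proof (rule Con_I_translations[OF alg])
  note Cm = alikeD(1)[OF al] alikeD(2)[OF al]
  let ?\<alpha> = "cover ar A \<phi>"
  note Cn = Cm_Con[OF Cm(1)] Cm_Con[OF Cm(2)]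
  have \<alpha>: "?\<alpha> \<in> Con ar A" by (rule cover_Con[OF alg Cm(1)])
  have eq: "cover ar A \<psi> = ?\<alpha>" using alikeD(3)[OF al] by simp
  note mem = mem_bullet[OF Cm(1), of _ _ \<phi> \<psi>]
  have "(x, z) \<in> ?\<beta>" if xy: "(x, y) \<in> ?\<beta>" and yz: "(y, z) \<in> ?\<beta>" for x y z
  proof -
    have a: "(x, y) \<in> ?\<alpha>" "(y, z) \<in> ?\<alpha>" "(x, z) \<in> ?\<alpha>"
      using xy yz mem Con_D(4)[OF \<alpha>, of x y z] by auto
    show ?thesis
    proof (cases "(unit, x) \<in> ?\<alpha>")
      case True
      then have u: "(unit, y) \<in> ?\<alpha>" "(unit, z) \<in> ?\<alpha>" using a Con_D(4)[OF \<alpha>] by metis+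
      note s1 = in_iff_same_side[OF Cm(1)] and s2 = in_iff_same_side[OF Cm(2), unfolded eq]
      show ?thesis
        using xy yz a(3) unfolding mem s1[OF True u(1)] s1[OF u] s1[OF True u(2)]
          s2[OF True u(1)] s2[OF u] s2[OF True u(2)] by blast
    next
      case False
      then have "(x, z) \<in> \<phi>" "(x, z) \<in> \<psi>"
        using cover_pairs_in_unit_class[OF Cm(1) a(3)]
          cover_pairs_in_unit_class[OF Cm(2), unfolded eq, OF a(3)] by blast+
      then show ?thesis using a(3) mem by simp
    qed
  qed
  then have tr: "trans ?\<beta>" by (rule transI)
  have "(y, x) \<in> ?\<beta>" if "(x, y) \<in> ?\<beta>" for x y
    using that Con_D(3)[OF \<alpha>] Con_D(3)[OF Cn(1)] Con_D(3)[OF Cn(2)] unfolding mem by metis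
  then have sy: "sym ?\<beta>" by (rule symI)
  have "(x, x) \<in> ?\<beta>" if "x \<in> carrier A" for x
    using that Con_D(2)[OF \<alpha>] Con_D(2)[OF Cn(1)] Con_D(2)[OF Cn(2)] mem by simp
  moreover have "?\<beta> \<subseteq> carrier A \<times> carrier A" unfolding bullet_def by blast
  ultimately show "equiv (carrier A) ?\<beta>" using tr sy by (simp add: equiv_def refl_on_def)
  fix p x y assume p: "congruence_preserving ar A p" and xy: "(x, y) \<in> ?\<beta>"
  have a: "(x, y) \<in> ?\<alpha>" using xy mem by simp
  have "(p x, p y) \<in> \<phi> \<longleftrightarrow> (p x, p y) \<in> \<psi>"
  proof (cases "(x, y) \<in> \<phi>")
    case True
    then show ?thesis
      using xy congruence_preservingD[OF p Cn(1)] congruence_preservingD[OF p Cn(2)] mem by blast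
  next
    case False
    then have "(x, y) \<in> ?\<alpha> - \<phi>" "(x, y) \<in> cover ar A \<psi> - \<psi>" using xy eq unfolding mem by auto
    then show ?thesis by (rule alikeD(4)[OF al p])
  qed
  then show "(p x, p y) \<in> ?\<beta>" using congruence_preservingD[OF p \<alpha> a] mem by simp
qed

text \<open>Let \<open>\<beta> = \<phi> \<bullet> \<psi>\<close> and \<open>\<alpha> = \<phi>\<^sup>+\<close>. The intervals \<open>I[\<phi> \<inter> \<psi>, \<psi>]\<close> and \<open>I[\<beta>, \<alpha>]\<close> are transposes, so \<open>\<alpha>\<close>
  covers \<open>\<beta>\<close>. If some \<open>\<theta> \<supset> \<beta>\<close> were not above \<open>\<alpha>\<close>, then \<open>\<theta> \<inter> \<alpha> = \<beta>\<close>, and pairs of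
  \<open>\<psi> - \<phi> \<inter> \<psi>\<close> could be translated along \<open>\<theta>\<close>; this confines the unit class of \<open>\<theta>\<close> to that of
  \<open>\<phi>\<^sup>+ = \<alpha>\<close> and gives \<open>\<theta> = \<beta>\<close>.\<close>

lemma bullet_in_Cm:
  assumes al: "alike \<phi> \<psi>" and ne: "\<phi> \<noteq> \<psi>"
  shows "bullet ar A \<phi> \<phi> \<psi> \<in> Cm ar A" "cover ar A (bullet ar A \<phi> \<phi> \<psi>) = cover ar A \<phi>"
    "(\<phi>, bullet ar A \<phi> \<phi> \<psi>) \<in> Cm_sim ar A"
proof -
  define \<beta> where "\<beta> = bullet ar A \<phi> \<phi> \<psi>"
  define \<alpha> where "\<alpha> = cover ar A \<phi>"
  note Cm = alikeD(1)[OF al] alikeD(2)[OF al]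
  note Cn = Cm_Con[OF Cm(1)] Cm_Con[OF Cm(2)]
  have eq: "cover ar A \<psi> = \<alpha>" using alikeD(3)[OF al] by (simp add: \<alpha>_def)
  have \<alpha>: "\<alpha> \<in> Con ar A" "\<phi> \<subset> \<alpha>" "\<psi> \<subset> \<alpha>"
    using cover_Con[OF alg Cm(1)] cover_above[OF alg Cm(1)] cover_above[OF alg Cm(2)] eq
    by (auto simp: \<alpha>_def)
  have \<beta>: "\<beta> \<in> Con ar A" unfolding \<beta>_def by (rule bullet_in_Con[OF al])
  have mem: "(u, v) \<in> \<beta> \<longleftrightarrow> (u, v) \<in> \<alpha> \<and> ((u, v) \<in> \<phi> \<longleftrightarrow> (u, v) \<in> \<psi>)" for u v
    using mem_bullet[OF Cm(1)] by (simp add: \<beta>_def \<alpha>_def)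
  have meets: "\<psi> \<inter> \<beta> = \<phi> \<inter> \<psi>" "\<phi> \<inter> \<psi> \<subseteq> \<beta>" "\<beta> \<subseteq> \<alpha>" using mem \<alpha>(2) by auto
  obtain x where x: "(unit, x) \<in> \<phi>" "(unit, x) \<notin> \<psi>"
    by (rule unit_class_witness[OF Cn not_subset_if_alike[OF al ne]])
  obtain y where y: "(unit, y) \<in> \<psi>" "(unit, y) \<notin> \<phi>"
    by (rule unit_class_witness[OF Cn(2,1) not_subset_if_alike[OF alike_sym[OF al] not_sym[OF ne]]])
  have xy: "(x, y) \<in> \<beta>" "(x, y) \<notin> \<phi>" "(x, y) \<notin> \<psi>"
  proof -
    show 1: "(x, y) \<notin> \<phi>" using x(1) y(2) Con_D(4)[OF Cn(1)] by blast
    show 2: "(x, y) \<notin> \<psi>" using x(2) y(1) Con_D(3)[OF Cn(2)] Con_D(4)[OF Cn(2)] by metis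
    have "(unit, x) \<in> \<alpha>" "(unit, y) \<in> \<alpha>" using x y \<alpha> by auto
    then have "(x, y) \<in> \<alpha>" using Con_D(3)[OF \<alpha>(1)] Con_D(4)[OF \<alpha>(1)] by metis
    then show "(x, y) \<in> \<beta>" using 1 2 mem by blast
  qed
  have t1: "((\<phi> \<inter> \<psi>, \<psi>), (\<phi>, \<alpha>)) \<in> transpose_up ar A"
    unfolding \<alpha>_def by (rule transpose_distinct_alike[OF al ne])
  then have c1: "covers (\<phi> \<inter> \<psi>) \<psi>"
    using transpose_covers_down covers_cover[OF Cm(1)] unfolding \<alpha>_def by blast
  have "\<not> \<beta> \<subseteq> \<psi>" using xy by blast
  then have "\<alpha> \<subseteq> join ar A \<beta> \<psi>" using cover_subset_join[OF Cm(2) \<beta>] eq by simp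
  moreover have "join ar A \<beta> \<psi> \<subseteq> \<alpha>" using meets(3) \<alpha> by (intro join_least) auto
  ultimately have "join ar A \<psi> \<beta> = \<alpha>" by (simp add: join_commute)
  then have t2: "((\<phi> \<inter> \<psi>, \<psi>), (\<beta>, \<alpha>)) \<in> transpose_up ar A"
    by (intro transpose_upI Cn(2) \<beta> meets(1))
  have c2: "covers \<beta> \<alpha>" by (rule transpose_covers_up[OF t2 c1])
  have above: "\<alpha> \<subseteq> \<theta>" if \<theta>: "\<theta> \<in> Con ar A" "\<beta> \<subset> \<theta>" for \<theta>
  proof (rule ccontr)
    assume not: "\<not> \<alpha> \<subseteq> \<theta>"
    have m: "\<theta> \<inter> \<alpha> = \<beta>"
      using covers_cases[OF c2 Con_Int[OF \<theta>(1) \<alpha>(1)]] \<theta>(2) meets(3) not by blast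
    have "\<not> \<theta> \<subseteq> \<phi>" using xy(1,2) \<theta>(2) by blast
    then have "\<alpha> \<subseteq> join ar A \<theta> \<phi>" using cover_subset_join[OF Cm(1) \<theta>(1)] by (simp add: \<alpha>_def)
    then have J: "\<psi> \<subseteq> join ar A \<theta> \<phi>" using \<alpha>(3) by blast
    have d: "\<psi> \<inter> \<theta> = \<phi> \<inter> \<psi>" "\<psi> \<inter> \<phi> = \<phi> \<inter> \<psi>" using m meets \<alpha>(3) by blast+
    have y': "(unit, y) \<in> \<psi> - \<phi> \<inter> \<psi>" using y by blast
    have "\<theta> \<subseteq> \<alpha>"
    proof (rule unit_class_subset[OF \<theta>(1) \<alpha>(1)])
      fix z assume "(unit, z) \<in> \<theta>"
      from translate_pair[OF \<theta>(1) Cn d J y' this]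
      obtain w where "(z, w) \<in> \<psi> - \<phi> \<inter> \<psi>" .
      then show "(unit, z) \<in> \<alpha>"
        using cover_pairs_in_unit_class[OF Cm(1), of z w] \<alpha>(3) unfolding \<alpha>_def by blast
    qed
    then show False using m \<theta>(2) by blast
  qed
  have "\<beta> \<subset> \<alpha>" by (rule covers_psubset[OF c2])
  then have "\<beta> \<in> Cm ar A" "cover ar A \<beta> = \<alpha>"
    using Cm_I[OF \<beta> _ \<alpha>(1) above] cover_eqI[OF \<alpha>(1) _ above] by blast+
  moreover have "((\<phi>, \<alpha>), (\<beta>, \<alpha>)) \<in> projective ar A"
    unfolding projective_def using t1 t2
    by (intro rtrancl_into_rtrancl[OF r_into_rtrancl, of "(\<phi>, \<alpha>)" "(\<phi> \<inter> \<psi>, \<psi>)"]) auto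
  ultimately show "bullet ar A \<phi> \<phi> \<psi> \<in> Cm ar A" "cover ar A (bullet ar A \<phi> \<phi> \<psi>) = cover ar A \<phi>"
    "(\<phi>, bullet ar A \<phi> \<phi> \<psi>) \<in> Cm_sim ar A"
    using Cm(1) by (simp_all add: Cm_sim_def \<beta>_def \<alpha>_def)
qed

section \<open>The correspondence\<close>

lemma equiv_Cm_sim: "equiv (Cm ar A) (Cm_sim ar A)"
proof (rule equivI)
  have "sym (transpose_up ar A \<union> (transpose_up ar A)\<inverse>)" by (rule symI) blast
  then have "sym (projective ar A)" unfolding projective_def by (rule sym_rtrancl)
  then show "sym (Cm_sim ar A)" unfolding sym_def Cm_sim_def by blast
  have "trans (projective ar A)" unfolding projective_def by (rule trans_rtrancl)
  then show "trans (Cm_sim ar A)" unfolding trans_def Cm_sim_def by blast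
  show "refl_on (Cm ar A) (Cm_sim ar A)"
    unfolding refl_on_def Cm_sim_def projective_def by simp
  show "Cm_sim ar A \<subseteq> Cm ar A \<times> Cm ar A" unfolding Cm_sim_def by blast
qed

lemma class_sim:
  assumes "U \<in> Cm ar A // Cm_sim ar A" "\<eta> \<in> U"
  shows "\<phi> \<in> U \<longleftrightarrow> (\<eta>, \<phi>) \<in> Cm_sim ar A"
proof -
  obtain \<mu> where "U = Cm_sim ar A `` {\<mu>}" using assms(1) by (rule quotientE)
  then show ?thesis
    using assms(2) equiv_Cm_sim by (metis Image_singleton_iff equivE symD transD)
qed

lemma class_cover:
  assumes "U \<in> Cm ar A // Cm_sim ar A" "\<eta> \<in> U" "\<phi> \<in> U"
  shows "\<phi> \<in> Cm ar A" "cover ar A \<phi> = cover ar A \<eta>" "\<phi> \<subset> cover ar A \<eta>"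
proof -
  have al: "alike \<eta> \<phi>" using class_sim[OF assms(1,2)] assms(3) by (intro Cm_sim_imp_alike) simp
  then show "\<phi> \<in> Cm ar A" "cover ar A \<phi> = cover ar A \<eta>" using alikeD(2,3)[OF al] by auto
  then show "\<phi> \<subset> cover ar A \<eta>" using cover_above[OF alg] by metis
qed

lemma class_bullet:
  assumes U: "U \<in> Cm ar A // Cm_sim ar A" and \<eta>: "\<eta> \<in> U" "\<phi> \<in> U" "\<psi> \<in> U" and ne: "\<phi> \<noteq> \<psi>"
  shows "bullet ar A \<eta> \<phi> \<psi> \<in> U"
proof -
  have "alike \<phi> \<psi>" using class_sim[OF U \<eta>(2)] \<eta>(3) by (intro Cm_sim_imp_alike) simp
  then have "(\<phi>, bullet ar A \<phi> \<phi> \<psi>) \<in> Cm_sim ar A" using ne by (rule bullet_in_Cm)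
  then show ?thesis
    using class_sim[OF U \<eta>(2)] bullet_cong[OF class_cover(2)[OF U \<eta>(1,2)]] by simp
qed

text \<open>Only products of distinct members of \<open>S\<close> matter: the cover is neutral, each element is its
  own inverse, and no such product is the cover.\<close>

lemma subgroup_bar_iff:
  assumes U: "U \<in> Cm ar A // Cm_sim ar A" and \<eta>: "\<eta> \<in> U" and S: "S \<subseteq> U"
  shows "subgroup (bar ar A \<eta> S) (bar_group ar A \<eta> U) \<longleftrightarrow>
    (\<forall>\<phi>\<in>S. \<forall>\<psi>\<in>S. \<phi> \<noteq> \<psi> \<longrightarrow> bullet ar A \<eta> \<phi> \<psi> \<in> S)"
    (is "subgroup ?S ?G \<longleftrightarrow> ?closed")
proof
  let ?\<alpha> = "cover ar A \<eta>"
  have G: "carrier ?G = insert ?\<alpha> U" "\<one>\<^bsub>?G\<^esub> = ?\<alpha>" "\<And>\<phi> \<psi>. \<phi> \<otimes>\<^bsub>?G\<^esub> \<psi> = bullet ar A \<eta> \<phi> \<psi>"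
    by (simp_all add: bar_group_def bar_def)
  have S': "?S = insert ?\<alpha> S" by (simp add: bar_def)
  have \<eta>Cm: "\<eta> \<in> Cm ar A" by (rule class_cover(1)[OF U \<eta> \<eta>])
  have below: "\<phi> \<subset> ?\<alpha>" if "\<phi> \<in> U" for \<phi> by (rule class_cover(3)[OF U \<eta> that])
  {
    assume sub: "subgroup ?S ?G"
    show ?closed
    proof (intro ballI impI)
      fix \<phi> \<psi> assume p: "\<phi> \<in> S" "\<psi> \<in> S" "\<phi> \<noteq> \<psi>"
      then have "bullet ar A \<eta> \<phi> \<psi> \<in> insert ?\<alpha> S"
        using subgroup.m_closed[OF sub, of \<phi> \<psi>] unfolding G S' by simp
      moreover have "bullet ar A \<eta> \<phi> \<psi> \<noteq> ?\<alpha>"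
        using bullet_eq_cover[OF \<eta>Cm, of \<phi> \<psi>] below[of \<phi>] below[of \<psi>] S p by blast
      ultimately show "bullet ar A \<eta> \<phi> \<psi> \<in> S" by simp
    qed
  }
  assume closed: ?closed
  show "subgroup ?S ?G"
  proof
    show "?S \<subseteq> carrier ?G" using S unfolding G S' by blast
    show "\<one>\<^bsub>?G\<^esub> \<in> ?S" unfolding G S' by simp
    fix \<phi> assume \<phi>: "\<phi> \<in> ?S"
    then have \<phi>_le: "\<phi> \<subseteq> ?\<alpha>" using S below unfolding S' by blast
    have "inv\<^bsub>?G\<^esub> \<phi> = \<phi>"
      unfolding m_inv_def
    proof (rule the_equality)
      show "\<phi> \<in> carrier ?G \<and> \<phi> \<otimes>\<^bsub>?G\<^esub> \<phi> = \<one>\<^bsub>?G\<^esub> \<and> \<phi> \<otimes>\<^bsub>?G\<^esub> \<phi> = \<one>\<^bsub>?G\<^esub>"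
        using \<phi> S bullet_self[OF \<eta>Cm] unfolding G S' by auto
      fix \<psi> assume \<psi>: "\<psi> \<in> carrier ?G \<and> \<phi> \<otimes>\<^bsub>?G\<^esub> \<psi> = \<one>\<^bsub>?G\<^esub> \<and> \<psi> \<otimes>\<^bsub>?G\<^esub> \<phi> = \<one>\<^bsub>?G\<^esub>"
      then have "\<psi> \<subseteq> ?\<alpha>" using below unfolding G by blast
      then show "\<psi> = \<phi>" using bullet_eq_cover[OF \<eta>Cm \<phi>_le] \<psi> unfolding G by metis
    qed
    then show "inv\<^bsub>?G\<^esub> \<phi> \<in> ?S" using \<phi> by simp
    fix \<psi> assume \<psi>: "\<psi> \<in> ?S"
    then have \<psi>_le: "\<psi> \<subseteq> ?\<alpha>" using S below unfolding S' by blast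
    consider "\<phi> = \<psi>" | "\<phi> = ?\<alpha>" | "\<psi> = ?\<alpha>" | "\<phi> \<in> S" "\<psi> \<in> S" "\<phi> \<noteq> \<psi>"
      using \<phi> \<psi> unfolding S' by blast
    then show "\<phi> \<otimes>\<^bsub>?G\<^esub> \<psi> \<in> ?S"
    proof cases
      case 1
      then show ?thesis unfolding G S' by (simp add: bullet_self[OF \<eta>Cm])
    next
      case 2
      then show ?thesis using \<psi> bullet_cover[OF \<eta>Cm \<psi>_le] unfolding G by simp
    next
      case 3
      then show ?thesis using \<phi> bullet_cover[OF \<eta>Cm \<phi>_le] bullet_commute unfolding G by metis
    next
      case 4
      then show ?thesis using closed unfolding G S' by blast
    qed
  qed
qed

lemma M_in_SS:
  assumes "\<theta> \<in> Con ar A" shows "M ar A \<theta> \<in> SS ar A"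
proof -
  have "subgroup (bar ar A \<eta> (M ar A \<theta> \<inter> U)) (bar_group ar A \<eta> U)"
    if U: "U \<in> Cm ar A // Cm_sim ar A" and \<eta>: "\<eta> \<in> U" for U \<eta>
    unfolding subgroup_bar_iff[OF U \<eta> inf_le2]
  proof (intro ballI impI)
    fix \<phi> \<psi> assume p: "\<phi> \<in> M ar A \<theta> \<inter> U" "\<psi> \<in> M ar A \<theta> \<inter> U" "\<phi> \<noteq> \<psi>"
    have b: "bullet ar A \<eta> \<phi> \<psi> \<in> U" using class_bullet[OF U \<eta>] p by blast
    have "\<phi> \<subseteq> cover ar A \<eta>" using class_cover(3)[OF U \<eta>] p(1) by blast
    moreover have "\<theta> \<subseteq> \<phi>" "\<theta> \<subseteq> \<psi>" using p(1,2) by (simp_all add: M_def)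
    ultimately have "\<theta> \<subseteq> bullet ar A \<eta> \<phi> \<psi>"
      by (intro subrelI) (simp add: mem_bullet[OF class_cover(1)[OF U \<eta> \<eta>]] subset_iff)
    then show "bullet ar A \<eta> \<phi> \<psi> \<in> M ar A \<theta> \<inter> U"
      using b class_cover(1)[OF U \<eta> b] by (simp add: M_def)
  qed
  moreover have "M ar A \<theta> \<in> Up_Cm ar A" unfolding M_def Up_Cm_def by auto
  ultimately show ?thesis unfolding SS_def by blast
qed

lemma inj_on_M: "inj_on (M ar A) (Con ar A)"
proof (rule inj_onI)
  have *: "\<beta> \<subseteq> \<alpha>" if C: "\<alpha> \<in> Con ar A" "\<beta> \<in> Con ar A" and M: "M ar A \<alpha> = M ar A \<beta>" for \<alpha> \<beta>
  proof (rule ccontr)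
    assume "\<not> \<beta> \<subseteq> \<alpha>"
    then obtain u v where uv: "(u, v) \<in> \<beta>" "(u, v) \<notin> \<alpha>" by auto
    then have "u \<in> carrier A" "v \<in> carrier A" using Con_D(1)[OF C(2)] by auto
    from Cm_separates[OF alg C(1) uv(2) this]
    obtain \<eta> where "\<eta> \<in> Cm ar A" "\<alpha> \<subseteq> \<eta>" "(u, v) \<notin> \<eta>" .
    then show False using M uv(1) unfolding M_def by blast
  qed
  fix \<alpha> \<beta> assume "\<alpha> \<in> Con ar A" "\<beta> \<in> Con ar A" "M ar A \<alpha> = M ar A \<beta>"
  then show "\<alpha> = \<beta>" using *[of \<alpha> \<beta>] *[of \<beta> \<alpha>] by simp
qed

text \<open>Let \<open>\<phi>\<close> be minimal in \<open>T\<close> and let \<open>\<delta>\<close> be the meet of the rest. If \<open>\<delta> \<subseteq> \<mu>\<close>, then \<open>\<phi>\<close> can be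
  dropped. Otherwise \<open>\<delta> \<subseteq> \<phi>\<^sup>+\<close> and \<open>\<delta> \<inter> \<phi> = \<delta> \<inter> \<mu>\<close>, so \<open>I[\<delta> \<inter> \<phi>, \<delta>]\<close> transposes up to the covers
  of both \<open>\<phi>\<close> and \<open>\<mu>\<close>, which puts \<open>\<phi>\<close> and \<open>\<mu>\<close> into the same class. Now \<open>\<delta> \<subseteq> \<phi> \<bullet> \<mu>\<close>, and \<open>\<mu>\<close> is
  recovered from \<open>\<phi> \<bullet> \<mu>\<close> and \<open>\<phi>\<close>.\<close>

lemma SS_contains_above_meet:
  assumes S: "S \<in> SS ar A" and fin: "finite T" and T: "T \<subseteq> S" "T \<in> Up_Cm ar A"
    and \<mu>: "\<mu> \<in> Cm ar A" "(carrier A \<times> carrier A) \<inter> \<Inter>T \<subseteq> \<mu>"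
  shows "\<mu> \<in> S"
  using fin T \<mu>
proof (induction "card T" arbitrary: T \<mu> rule: less_induct)
  case less
  note T = less.prems(1-3) and \<mu> = less.prems(4,5)
  have TCm: "T \<subseteq> Cm ar A" and up: "\<And>\<phi> \<psi>. \<phi> \<in> T \<Longrightarrow> \<psi> \<in> Cm ar A \<Longrightarrow> \<phi> \<subseteq> \<psi> \<Longrightarrow> \<psi> \<in> T"
    using T(3) unfolding Up_Cm_def by blast+
  have "T \<noteq> {}"
  proof
    assume "T = {}"
    then show False
      using \<mu>(2) cover_above[OF alg \<mu>(1)] Con_D(1)[OF cover_Con[OF alg \<mu>(1)]] by auto
  qed
  then obtain \<phi> where \<phi>: "\<phi> \<in> T" and min: "\<And>\<psi>. \<psi> \<in> T \<Longrightarrow> \<psi> \<subseteq> \<phi> \<Longrightarrow> \<phi> = \<psi>"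
    using finite_has_minimal[OF T(1)] by blast
  define R where "R = T - {\<phi>}"
  define \<delta> where "\<delta> = (carrier A \<times> carrier A) \<inter> \<Inter>R"
  have R: "finite R" "R \<subseteq> S" "card R < card T"
    using T card_Diff1_less[OF T(1) \<phi>] by (auto simp: R_def)
  have RUp: "R \<in> Up_Cm ar A" unfolding Up_Cm_def R_def using TCm up min by blast
  note IH = less.hyps[OF R(3,1,2) RUp]
  have \<phi>Cm: "\<phi> \<in> Cm ar A" using \<phi> TCm by blast
  note Cn = Cm_Con[OF \<phi>Cm] Cm_Con[OF \<mu>(1)]
  show ?case
  proof (cases "\<delta> \<subseteq> \<mu>")
    case True
    then show ?thesis using IH[OF \<mu>(1)] by (simp add: \<delta>_def)
  next
    case False
    have \<delta>: "\<delta> \<in> Con ar A"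
      unfolding \<delta>_def using TCm Cm_Con by (intro Con_Inter[OF alg]) (auto simp: R_def)
    have m: "\<delta> \<inter> \<phi> \<subseteq> \<mu>" using \<mu>(2) unfolding \<delta>_def R_def by blast
    have \<delta>_le: "\<delta> \<subseteq> cover ar A \<phi>"
    proof (rule ccontr)
      assume "\<not> \<delta> \<subseteq> cover ar A \<phi>"
      then obtain u v where uv: "(u, v) \<in> \<delta>" "(u, v) \<notin> cover ar A \<phi>" by auto
      then have "u \<in> carrier A" "v \<in> carrier A" using Con_D(1)[OF \<delta>] by auto
      from Cm_separates[OF alg cover_Con[OF alg \<phi>Cm] uv(2) this]
      obtain \<eta> where \<eta>: "\<eta> \<in> Cm ar A" "cover ar A \<phi> \<subseteq> \<eta>" "(u, v) \<notin> \<eta>" .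
      then have "\<eta> \<in> R" using cover_above[OF alg \<phi>Cm] up[OF \<phi> \<eta>(1)] by (auto simp: R_def)
      then show False using uv(1) \<eta>(3) by (auto simp: \<delta>_def)
    qed
    have "\<not> \<delta> \<subseteq> \<phi>" using m False by blast
    then have "cover ar A \<phi> \<subseteq> join ar A \<delta> \<phi>" by (rule cover_subset_join[OF \<phi>Cm \<delta>])
    moreover have "join ar A \<delta> \<phi> \<subseteq> cover ar A \<phi>"
      using \<delta>_le cover_above[OF alg \<phi>Cm] by (intro join_least cover_Con[OF alg \<phi>Cm]) auto
    ultimately have "join ar A \<delta> \<phi> = cover ar A \<phi>" by blast
    then have t1: "((\<delta> \<inter> \<phi>, \<delta>), (\<phi>, cover ar A \<phi>)) \<in> transpose_up ar A"
      by (intro transpose_upI[OF \<delta> Cn(1) refl])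
    have c: "covers (\<delta> \<inter> \<phi>) \<delta>" by (rule transpose_covers_down[OF t1 covers_cover[OF \<phi>Cm]])
    have e: "\<delta> \<inter> \<mu> = \<delta> \<inter> \<phi>"
      using covers_cases[OF c Con_Int[OF \<delta> Cn(2)]] m False by blast
    have t2: "((\<delta> \<inter> \<phi>, \<delta>), (\<mu>, cover ar A \<mu>)) \<in> transpose_up ar A"
      by (rule cover_eq_join(2)[OF \<mu>(1) c e])
    have "((\<phi>, cover ar A \<phi>), (\<mu>, cover ar A \<mu>)) \<in> projective ar A"
      unfolding projective_def using t1 t2
      by (intro rtrancl_into_rtrancl[OF r_into_rtrancl, of _ "(\<delta> \<inter> \<phi>, \<delta>)"]) auto
    then have sim: "(\<phi>, \<mu>) \<in> Cm_sim ar A" using \<phi>Cm \<mu>(1) by (simp add: Cm_sim_def)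
    show ?thesis
    proof (cases "\<phi> = \<mu>")
      case True
      then show ?thesis using \<phi> T(2) by blast
    next
      case ne: False
      define U where "U = Cm_sim ar A `` {\<phi>}"
      define \<sigma> where "\<sigma> = bullet ar A \<phi> \<phi> \<mu>"
      have U: "U \<in> Cm ar A // Cm_sim ar A" unfolding U_def by (rule quotientI[OF \<phi>Cm])
      have \<phi>U: "\<phi> \<in> U" unfolding U_def by (rule equiv_class_self[OF equiv_Cm_sim \<phi>Cm])
      have \<mu>U: "\<mu> \<in> U" using sim by (simp add: U_def)
      have \<sigma>U: "\<sigma> \<in> U" unfolding \<sigma>_def by (rule class_bullet[OF U \<phi>U \<phi>U \<mu>U ne])
      have "\<delta> \<subseteq> \<sigma>" using \<delta>_le e mem_bullet[OF \<phi>Cm] unfolding \<sigma>_def by auto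
      then have "\<sigma> \<in> S" using IH[OF class_cover(1)[OF U \<phi>U \<sigma>U]] by (simp add: \<delta>_def)
      have \<mu>_le: "\<mu> \<subset> cover ar A \<phi>" by (rule class_cover(3)[OF U \<phi>U \<mu>U])
      have cancel: "bullet ar A \<phi> \<sigma> \<phi> = \<mu>" unfolding \<sigma>_def using bullet_cancel[OF \<phi>Cm] \<mu>_le by blast
      have "\<sigma> \<noteq> \<phi>" using cancel bullet_self[OF \<phi>Cm] \<mu>_le by auto
      moreover have "subgroup (bar ar A \<phi> (S \<inter> U)) (bar_group ar A \<phi> U)"
        using S U \<phi>U unfolding SS_def by blast
      ultimately have "bullet ar A \<phi> \<sigma> \<phi> \<in> S \<inter> U"
        using \<open>\<sigma> \<in> S\<close> \<sigma>U \<phi>U \<phi> T(2) unfolding subgroup_bar_iff[OF U \<phi>U inf_le2] by blast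
      then show ?thesis unfolding cancel by blast
    qed
  qed
qed

lemma finite_Con: "finite (carrier A) \<Longrightarrow> finite (Con ar A)"
  using Con_D(1) by (intro finite_subset[of "Con ar A" "Pow (carrier A \<times> carrier A)"]) auto

lemma SS_subset_range_M:
  assumes fin: "finite (carrier A)" and S: "S \<in> SS ar A"
  shows "S \<in> M ar A ` Con ar A"
proof -
  let ?\<theta> = "(carrier A \<times> carrier A) \<inter> \<Inter>S"
  have Up: "S \<in> Up_Cm ar A" using S by (simp add: SS_def)
  then have Cm: "S \<subseteq> Cm ar A" by (simp add: Up_Cm_def)
  then have C: "S \<subseteq> Con ar A" using Cm_Con by blast
  have "finite S" using finite_subset[OF C finite_Con[OF fin]] .
  then have "M ar A ?\<theta> \<subseteq> S" using SS_contains_above_meet[OF S _ subset_refl Up] by (auto simp: M_def)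
  moreover have "S \<subseteq> M ar A ?\<theta>" using Cm by (auto simp: M_def)
  ultimately show ?thesis using Con_Inter[OF alg C] by blast
qed

end

theorem theorem23:
  fixes ar :: "'f \<Rightarrow> nat" and t :: "'f trm" and A :: "('a, 'f) ualg"
  assumes "ualgebra ar A"
    and "constant_term ar A t"
    and "strongly_Fregean ar t A"
  shows "M ar A ` Con ar A \<subseteq> SS ar A \<and>
    (finite (carrier A) \<longrightarrow> bij_betw (M ar A) (Con ar A) (SS ar A))"
proof -
  interpret strongly_Fregean_algebra ar t A by unfold_locales fact+
  have "M ar A ` Con ar A \<subseteq> SS ar A" using M_in_SS by blast
  then show ?thesis using SS_subset_range_M inj_on_M unfolding bij_betw_def by blast
qed

end
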